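(* Let $G$ be a discrete group and let $\mathcal{T}$ be a transversal for $FC(G)$ in $G$. The weak*-closed ideals of $\ell^1(G)$ are exactly the subspaces of the form $$\bigoplus_{t \in \mathcal{T}} \delta_t*J,$$ where $J$ is a weak*-closed ideal of $\ell^1(FC(G))$ that is invariant for the action of $G$ by conjugation.
   Context: $\ell^1(G)$ is the complex convolution algebra of the discrete group $G$, with weak*-topology given by $\ell^1(G)=c_0(G)^*$; similarly for $\ell^1(N)$ for a subgroup $N$, and $\ell^1(N)$ is regarded as a subset of $\ell^1(G)$ by extending functions by zero. "Ideal" means two-sided ideal. $FC(G)=\{t\in G : \text{the conjugacy class of } t \text{ in } G \text{ is finite}\}$, a normal subgroup of $G$. A transversal for a normal subgroup is a set of coset representatives. For $f\in \ell^1(G)$ and $s\in G$, $f^s=\delta_s*f*\delta_{s^{-1}}$; $J$ is invariant for the action of $G$ by conjugation if $J^s=\{f^s:f\in J\}=J$ for all $s\in G$. The sum $\bigoplus_{t\in\mathcal T}\delta_t*J$ is an internal ($\ell^1$-)direct sum: it is the set of all $f\in\ell^1(G)$ of the form $f=\sum_{t\in\mathcal T}\delta_t*f_t$ (convergent in $\ell^1$-norm) with each $f_t\in J$; equivalently the set of $f\in\ell^1(G)$ such that $(\delta_{t^{-1}}*f)|_{FC(G)}\in J$ for every $t\in\mathcal T$. *)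

theory Defs
  imports "HOL-Analysis.Analysis" "HOL-Algebra.Ideal" "HOL-Algebra.Left_Coset"
begin

section \<open>The convolution algebra of a discrete group\<close>

text \<open>
  Functions on a group \<open>G\<close> are functions on the ambient type that vanish off \<open>carrier G\<close>. For a
  subgroup \<open>N\<close>, the space \<open>l1 (G\<lparr>carrier := N\<rparr>)\<close> is therefore literally a subset of \<open>l1 G\<close>: the
  extension by zero is built in.
\<close>

definition l1 :: "('a, 'b) monoid_scheme \<Rightarrow> ('a \<Rightarrow> complex) set" where
  "l1 G = {f. (\<forall>x. x \<notin> carrier G \<longrightarrow> f x = 0) \<and> (\<lambda>x. norm (f x)) summable_on carrier G}"

definition l1_norm :: "('a, 'b) monoid_scheme \<Rightarrow> ('a \<Rightarrow> complex) \<Rightarrow> real" where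
  "l1_norm G f = (\<Sum>\<^sub>\<infinity>x\<in>carrier G. norm (f x))"

definition conv :: "('a, 'b) monoid_scheme \<Rightarrow> ('a \<Rightarrow> complex) \<Rightarrow> ('a \<Rightarrow> complex) \<Rightarrow> 'a \<Rightarrow> complex" where
  "conv G f g = (\<lambda>x. if x \<in> carrier G
     then \<Sum>\<^sub>\<infinity>y\<in>carrier G. f y * g (inv\<^bsub>G\<^esub> y \<otimes>\<^bsub>G\<^esub> x) else 0)"

definition delta :: "'a \<Rightarrow> 'a \<Rightarrow> complex" where
  "delta s = (\<lambda>x. if x = s then 1 else 0)"

definition l1_algebra :: "('a, 'b) monoid_scheme \<Rightarrow> ('a \<Rightarrow> complex) ring" where
  "l1_algebra G = \<lparr>carrier = l1 G, mult = conv G, one = delta \<one>\<^bsub>G\<^esub>,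
     zero = (\<lambda>_. 0), add = (\<lambda>f g x. f x + g x)\<rparr>"

text \<open>Two-sided ideals of the complex algebra, i.e. ring ideals that are complex subspaces. (The
  algebra is unital, so the scalar condition is in fact automatic.)\<close>

definition l1_ideal :: "('a, 'b) monoid_scheme \<Rightarrow> ('a \<Rightarrow> complex) set \<Rightarrow> bool" where
  "l1_ideal G J \<longleftrightarrow> ideal J (l1_algebra G) \<and> (\<forall>c. \<forall>f\<in>J. (\<lambda>x. c * f x) \<in> J)"

section \<open>The weak*-topology\<close>

definition c0 :: "('a, 'b) monoid_scheme \<Rightarrow> ('a \<Rightarrow> complex) set" where
  "c0 G = {h. (\<forall>x. x \<notin> carrier G \<longrightarrow> h x = 0) \<and> (\<forall>e>0. finite {x \<in> carrier G. norm (h x) \<ge> e})}"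

text \<open>The coarsest topology on \<open>l1 G\<close> making \<open>f \<mapsto> \<Sum>x. f x * h x\<close> continuous for every \<open>h\<close> in
  \<open>c0 G\<close>, i.e. the weak*-topology under the usual identification of \<open>l1 G\<close> with the dual of \<open>c0 G\<close>.\<close>

definition weak_star :: "('a, 'b) monoid_scheme \<Rightarrow> ('a \<Rightarrow> complex) topology" where
  "weak_star G = topology_generated_by
     {{f \<in> l1 G. (\<Sum>\<^sub>\<infinity>x\<in>carrier G. f x * h x) \<in> U} |h U. h \<in> c0 G \<and> open U}"

section \<open>The FC-centre, transversals, and direct sums over cosets\<close>

definition FC :: "('a, 'b) monoid_scheme \<Rightarrow> 'a set" where
  "FC G = {t \<in> carrier G. finite {s \<otimes>\<^bsub>G\<^esub> t \<otimes>\<^bsub>G\<^esub> inv\<^bsub>G\<^esub> s |s. s \<in> carrier G}}"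

definition transversal :: "('a, 'b) monoid_scheme \<Rightarrow> 'a set \<Rightarrow> 'a set \<Rightarrow> bool" where
  "transversal G N T \<longleftrightarrow> T \<subseteq> carrier G \<and> (\<forall>C \<in> lcosets\<^bsub>G\<^esub> N. \<exists>!t. t \<in> T \<inter> C)"

definition conj_invariant :: "('a, 'b) monoid_scheme \<Rightarrow> ('a \<Rightarrow> complex) set \<Rightarrow> bool" where
  "conj_invariant G J \<longleftrightarrow>
     (\<forall>s \<in> carrier G. (\<lambda>f. conv G (conv G (delta s) f) (delta (inv\<^bsub>G\<^esub> s))) ` J = J)"

text \<open>The sums converge unconditionally in norm: the limit is taken along the finite subsets of the
  possibly uncountable set \<open>T\<close>.\<close>

definition l1_direct_sum ::
    "('a, 'b) monoid_scheme \<Rightarrow> 'a set \<Rightarrow> ('a \<Rightarrow> complex) set \<Rightarrow> ('a \<Rightarrow> complex) set" where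
  "l1_direct_sum G T J = {f \<in> l1 G. \<exists>F. (\<forall>t\<in>T. F t \<in> J) \<and>
     ((\<lambda>S. l1_norm G (\<lambda>x. f x - (\<Sum>t\<in>S. conv G (delta t) (F t) x))) \<longlongrightarrow> 0)
       (finite_subsets_at_top T)}"

section \<open>Basic facts\<close>

lemma zero_in_c0: "(\<lambda>_. 0) \<in> c0 G"
  by (auto simp: c0_def)

lemma topspace_weak_star [simp]: "topspace (weak_star G) = l1 G"
proof -
  have "l1 G \<in> {{f \<in> l1 G. (\<Sum>\<^sub>\<infinity>x\<in>carrier G. f x * h x) \<in> U} |h U. h \<in> c0 G \<and> open U}"
    using zero_in_c0 by (intro CollectI exI[of _ "\<lambda>_. 0"] exI[of _ UNIV]) auto
  then show ?thesis
    unfolding weak_star_def topology_generated_by_topspace by blast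
qed

lemma delta_in_l1: "s \<in> carrier G \<Longrightarrow> delta s \<in> l1 G"
proof -
  assume "s \<in> carrier G"
  then have "(\<lambda>x. norm (delta s x)) summable_on carrier G \<longleftrightarrow> (\<lambda>x. norm (delta s x)) summable_on {s}"
    by (intro summable_on_cong_neutral) (auto simp: delta_def)
  with \<open>s \<in> carrier G\<close> show "delta s \<in> l1 G"
    by (auto simp: l1_def delta_def)
qed

lemma l1_summable: "f \<in> l1 G \<Longrightarrow> f summable_on carrier G"
  by (auto simp: l1_def intro: Infinite_Sum.abs_summable_summable)

lemma l1_add:
  assumes "f \<in> l1 G" "g \<in> l1 G"
  shows "(\<lambda>x. f x + g x) \<in> l1 G"
proof -
  have "(\<lambda>x. norm (f x) + norm (g x)) summable_on carrier G"
    using assms by (intro summable_on_add) (auto simp: l1_def)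
  then have "(\<lambda>x. norm (f x + g x)) summable_on carrier G"
    by (rule summable_on_comparison_test) (auto intro: norm_triangle_ineq)
  then show ?thesis
    using assms by (auto simp: l1_def)
qed

lemma l1_scale: "f \<in> l1 G \<Longrightarrow> (\<lambda>x. c * f x) \<in> l1 G"
  by (auto simp: l1_def norm_mult intro: summable_on_cmult_right)

context group
begin

lemma bij_betw_left_translation:
  "y \<in> carrier G \<Longrightarrow> bij_betw (\<lambda>x. inv y \<otimes> x) (carrier G) (carrier G)"
  by (rule bij_betwI[where g = "\<lambda>x. y \<otimes> x"]) (auto simp: m_assoc[symmetric])

lemma conv_abs_summable:
  assumes "f \<in> l1 G" "g \<in> l1 G"
  shows "(\<lambda>p. norm (case p of (y, x) \<Rightarrow> f y * g (inv y \<otimes> x))) summable_on carrier G \<times> carrier G"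
proof (subst Infinite_Sum.abs_summable_on_Sigma_iff, intro conjI ballI)
  have g: "(\<lambda>x. norm (g (inv y \<otimes> x))) summable_on carrier G"
    "(\<Sum>\<^sub>\<infinity>x\<in>carrier G. norm (g (inv y \<otimes> x))) = l1_norm G g" if "y \<in> carrier G" for y
    using assms summable_on_reindex_bij_betw[OF bij_betw_left_translation[OF that], of "\<lambda>x. norm (g x)"]
      infsum_reindex_bij_betw[OF bij_betw_left_translation[OF that], of "\<lambda>x. norm (g x)"]
    by (auto simp: l1_def l1_norm_def)
  show "(\<lambda>x. norm (case (y, x) of (y, x) \<Rightarrow> f y * g (inv y \<otimes> x))) summable_on carrier G"
    if "y \<in> carrier G" for y
    using g(1)[OF that] by (auto simp: norm_mult intro: summable_on_cmult_right)
  have "(\<lambda>y. norm (f y) * l1_norm G g) summable_on carrier G"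
    using assms by (auto simp: l1_def intro: summable_on_cmult_left)
  moreover have "l1_norm G g \<ge> 0"
    by (auto simp: l1_norm_def intro: infsum_nonneg)
  ultimately show "(\<lambda>y. norm (\<Sum>\<^sub>\<infinity>x\<in>carrier G. norm (case (y, x) of (y, x) \<Rightarrow> f y * g (inv y \<otimes> x))))
      summable_on carrier G"
    by (auto simp: norm_mult infsum_cmult_right' g abs_mult cong: summable_on_cong)
qed

lemma conv_abs_summable':
  assumes "f \<in> l1 G" "g \<in> l1 G"
  shows "(\<lambda>p. norm (case p of (x, y) \<Rightarrow> f y * g (inv y \<otimes> x))) summable_on carrier G \<times> carrier G"
  using conv_abs_summable[OF assms]
  by (subst summable_on_swap) (auto simp: case_prod_unfold)

lemma conv_summand_abs_summable:
  assumes "f \<in> l1 G" "g \<in> l1 G" "x \<in> carrier G"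
  shows "(\<lambda>y. norm (f y * g (inv y \<otimes> x))) summable_on carrier G"
  using conv_abs_summable'[OF assms(1,2)] assms(3)
  unfolding Infinite_Sum.abs_summable_on_Sigma_iff by auto

lemmas conv_summand_summable = Infinite_Sum.abs_summable_summable[OF conv_summand_abs_summable]

lemma conv_in_l1:
  assumes "f \<in> l1 G" "g \<in> l1 G"
  shows "conv G f g \<in> l1 G"
proof -
  have "(\<lambda>x. \<Sum>\<^sub>\<infinity>y\<in>carrier G. norm (f y * g (inv y \<otimes> x))) summable_on carrier G"
    using conv_abs_summable'[OF assms] unfolding Infinite_Sum.abs_summable_on_Sigma_iff
    by (auto simp: abs_of_nonneg[OF infsum_nonneg])
  then have "(\<lambda>x. norm (conv G f g x)) summable_on carrier G"
    by (rule summable_on_comparison_test)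
      (auto simp: conv_def intro: norm_infsum_bound conv_summand_abs_summable[OF assms])
  then show ?thesis
    by (auto simp: l1_def conv_def)
qed

lemma l1_bounded:
  assumes "f \<in> l1 G"
  shows "norm (f x) \<le> l1_norm G f"
proof (cases "x \<in> carrier G")
  case True
  then show ?thesis
    using finite_sum_le_infsum[of "\<lambda>x. norm (f x)" "carrier G" "{x}"] assms
    by (auto simp: l1_def l1_norm_def)
next
  case False
  then show ?thesis
    using assms by (auto simp: l1_def l1_norm_def intro: infsum_nonneg)
qed

lemma conv_assoc:
  assumes f: "f \<in> l1 G" and g: "g \<in> l1 G" and h: "h \<in> l1 G"
  shows "conv G (conv G f g) h = conv G f (conv G g h)"
proof
  fix x
  show "conv G (conv G f g) h x = conv G f (conv G g h) x"
  proof (cases "x \<in> carrier G")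
    case x: True
    let ?k = "\<lambda>y z. f z * g (inv z \<otimes> y) * h (inv y \<otimes> x)"
    have "(\<lambda>p. l1_norm G h * norm ((\<lambda>(y, z). f z * g (inv z \<otimes> y)) p))
        summable_on carrier G \<times> carrier G"
      by (rule summable_on_cmult_right[OF conv_abs_summable'[OF f g]])
    then have "(\<lambda>p. norm (case p of (y, z) \<Rightarrow> ?k y z)) summable_on carrier G \<times> carrier G"
      by (rule summable_on_comparison_test)
        (auto simp: norm_mult mult.commute[of "l1_norm G h"] intro!: mult_left_mono l1_bounded h)
    then have k: "(\<lambda>(y, z). ?k y z) summable_on carrier G \<times> carrier G"
      by (rule Infinite_Sum.abs_summable_summable)
    have "conv G (conv G f g) h x = (\<Sum>\<^sub>\<infinity>y\<in>carrier G. \<Sum>\<^sub>\<infinity>z\<in>carrier G. ?k y z)"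
      using x by (auto simp: conv_def infsum_cmult_left' intro!: infsum_cong)
    also have "\<dots> = (\<Sum>\<^sub>\<infinity>z\<in>carrier G. \<Sum>\<^sub>\<infinity>y\<in>carrier G. ?k y z)"
      by (rule infsum_swap_banach[OF k])
    also have "\<dots> = (\<Sum>\<^sub>\<infinity>z\<in>carrier G. f z *
        (\<Sum>\<^sub>\<infinity>w\<in>carrier G. g w * h (inv w \<otimes> (inv z \<otimes> x))))"
    proof (rule infsum_cong)
      fix z assume z: "z \<in> carrier G"
      have cancel: "inv (inv z \<otimes> y) \<otimes> (inv z \<otimes> x) = inv y \<otimes> x" if "y \<in> carrier G" for y
      proof -
        have "inv (inv z \<otimes> y) \<otimes> (inv z \<otimes> x) = inv y \<otimes> (z \<otimes> (inv z \<otimes> x))"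
          using that x z by (simp add: inv_mult_group m_assoc)
        also have "z \<otimes> (inv z \<otimes> x) = x"
          using x z by (simp flip: m_assoc)
        finally show ?thesis .
      qed
      have "(\<Sum>\<^sub>\<infinity>w\<in>carrier G. g w * h (inv w \<otimes> (inv z \<otimes> x))) =
          (\<Sum>\<^sub>\<infinity>y\<in>carrier G. g (inv z \<otimes> y) * h (inv (inv z \<otimes> y) \<otimes> (inv z \<otimes> x)))"
        by (rule infsum_reindex_bij_betw[OF bij_betw_left_translation[OF z], symmetric])
      also have "\<dots> = (\<Sum>\<^sub>\<infinity>y\<in>carrier G. g (inv z \<otimes> y) * h (inv y \<otimes> x))"
        using x z by (intro infsum_cong) (simp add: cancel)
      finally show "(\<Sum>\<^sub>\<infinity>y\<in>carrier G. ?k y z) =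
          f z * (\<Sum>\<^sub>\<infinity>w\<in>carrier G. g w * h (inv w \<otimes> (inv z \<otimes> x)))"
        by (simp add: mult.assoc infsum_cmult_right')
    qed
    also have "\<dots> = conv G f (conv G g h) x"
      using x by (auto simp: conv_def intro!: infsum_cong)
    finally show ?thesis .
  qed (simp add: conv_def)
qed

lemma conv_delta_left:
  assumes "s \<in> carrier G" "x \<in> carrier G"
  shows "conv G (delta s) f x = f (inv s \<otimes> x)"
proof -
  have "(\<Sum>\<^sub>\<infinity>y\<in>carrier G. delta s y * f (inv y \<otimes> x)) = (\<Sum>\<^sub>\<infinity>y\<in>{s}. delta s y * f (inv y \<otimes> x))"
    using assms by (intro infsum_cong_neutral) (auto simp: delta_def)
  then show ?thesis
    using assms by (simp add: conv_def delta_def)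
qed

lemma conv_delta_right:
  assumes "s \<in> carrier G" "x \<in> carrier G"
  shows "conv G f (delta s) x = f (x \<otimes> inv s)"
proof -
  have *: "inv y \<otimes> x = s \<longleftrightarrow> y = x \<otimes> inv s" if "y \<in> carrier G" for y
    using assms that by (metis inv_closed inv_inv inv_solve_left inv_solve_right m_closed)
  have "(\<Sum>\<^sub>\<infinity>y\<in>carrier G. f y * delta s (inv y \<otimes> x)) =
      (\<Sum>\<^sub>\<infinity>y\<in>{x \<otimes> inv s}. f y * delta s (inv y \<otimes> x))"
    using assms by (intro infsum_cong_neutral) (auto simp: delta_def *)
  also have "\<dots> = f (x \<otimes> inv s)"
    using assms by (simp add: delta_def *)
  finally show ?thesis
    using assms by (simp add: conv_def)
qed

lemma ring_l1_algebra: "ring (l1_algebra G)"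
proof (rule ringI)
  have zero: "(\<lambda>_. 0) \<in> l1 G"
    by (simp add: l1_def)
  show "abelian_group (l1_algebra G)"
  proof (rule abelian_groupI)
    fix f assume "f \<in> carrier (l1_algebra G)"
    then show "\<exists>g\<in>carrier (l1_algebra G). g \<oplus>\<^bsub>l1_algebra G\<^esub> f = \<zero>\<^bsub>l1_algebra G\<^esub>"
      using l1_scale[of f G "-1"] by (intro bexI[of _ "\<lambda>x. - f x"]) (auto simp: l1_algebra_def)
  qed (simp_all add: l1_algebra_def l1_add zero add_ac)
  show "monoid (l1_algebra G)"
  proof (rule monoidI)
    fix f assume "f \<in> carrier (l1_algebra G)"
    then have f: "f x = 0" if "x \<notin> carrier G" for x
      using that by (auto simp: l1_algebra_def l1_def)
    show "\<one>\<^bsub>l1_algebra G\<^esub> \<otimes>\<^bsub>l1_algebra G\<^esub> f = f" "f \<otimes>\<^bsub>l1_algebra G\<^esub> \<one>\<^bsub>l1_algebra G\<^esub> = f"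
    proof (safe intro!: ext)
      fix x
      show "(\<one>\<^bsub>l1_algebra G\<^esub> \<otimes>\<^bsub>l1_algebra G\<^esub> f) x = f x" "(f \<otimes>\<^bsub>l1_algebra G\<^esub> \<one>\<^bsub>l1_algebra G\<^esub>) x = f x"
        using f conv_delta_left[of \<one> x f] conv_delta_right[of \<one> x f]
        by (cases "x \<in> carrier G"; simp add: l1_algebra_def conv_def)+
    qed
  qed (auto simp: l1_algebra_def conv_in_l1 conv_assoc delta_in_l1)
next
  fix f g h
  assume "f \<in> carrier (l1_algebra G)" "g \<in> carrier (l1_algebra G)" "h \<in> carrier (l1_algebra G)"
  then have [simp]: "f \<in> l1 G" "g \<in> l1 G" "h \<in> l1 G"
    by (auto simp: l1_algebra_def)
  show "(f \<oplus>\<^bsub>l1_algebra G\<^esub> g) \<otimes>\<^bsub>l1_algebra G\<^esub> h =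
      f \<otimes>\<^bsub>l1_algebra G\<^esub> h \<oplus>\<^bsub>l1_algebra G\<^esub> g \<otimes>\<^bsub>l1_algebra G\<^esub> h"
    by (auto simp: l1_algebra_def conv_def fun_eq_iff distrib_right infsum_add conv_summand_summable)
  show "h \<otimes>\<^bsub>l1_algebra G\<^esub> (f \<oplus>\<^bsub>l1_algebra G\<^esub> g) =
      h \<otimes>\<^bsub>l1_algebra G\<^esub> f \<oplus>\<^bsub>l1_algebra G\<^esub> h \<otimes>\<^bsub>l1_algebra G\<^esub> g"
    by (auto simp: l1_algebra_def conv_def fun_eq_iff distrib_left infsum_add conv_summand_summable)
qed

end

end

theory Submission
  imports Defs
begin

text \<open>
  Write \<open>N\<close> for the FC-centre. The heart of the matter is that a weak*-closed ideal \<open>I\<close> contains the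
  restriction to \<open>N\<close> of each of its elements \<open>f\<close> (\<open>restrict_FC_in_ideal\<close>). This is achieved by
  conjugation alone. A finite subset of \<open>N\<close> is centralized by a subgroup of finite index, whereas
  each point outside \<open>N\<close> has a centralizer of infinite index; since a group is not a finite union of
  cosets of subgroups of infinite index (B. H. Neumann), some \<open>s\<close> centralizes a given finite subset of
  \<open>N\<close> and at the same time moves a given finite set outside \<open>N\<close> off itself
  (\<open>exists_centralizing_displacement\<close>). The conjugates of \<open>f\<close> by such \<open>s\<close> all lie in \<open>I\<close> and have
  the same norm, keep the values of \<open>f\<close> on more and more of \<open>N\<close>, and tend to \<open>0\<close> pointwise off \<open>N\<close>.
  A bounded pointwise convergent net converges weak* (\<open>limitin_weak_star\<close>), so the restriction is in
  \<open>I\<close>.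

  Applied to the left translates of \<open>f\<close>, this puts into \<open>J = I \<inter> l1 N\<close> the part of \<open>f\<close> over every
  coset of \<open>N\<close>. As \<open>f\<close> is the norm limit of the finite sums of its parts, \<open>I\<close> is the direct sum of
  the translates of \<open>J\<close> (\<open>closed_ideal_is_direct_sum\<close>).

  Conversely, the direct sum for a given \<open>J\<close> consists of the \<open>f\<close> all of whose coset parts lie in \<open>J\<close>
  (\<open>l1_direct_sum_eq\<close>). It is weak*-closed because taking a coset part is weak*-continuous. It is
  invariant under left translation because \<open>J\<close> is an ideal, and under right translation because \<open>J\<close> is
  moreover invariant under conjugation. A weak*-closed subspace that is invariant under translations is
  an ideal, since a convolution product is a limit of combinations of translates
  (\<open>direct_sum_is_closed_ideal\<close>).
\<close>

section \<open>Separating finite sets by conjugation\<close>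

context group
begin

lemma cancel_inv [simp]:
  assumes "a \<in> carrier G" "b \<in> carrier G"
  shows "inv a \<otimes> (a \<otimes> b) = b" "a \<otimes> (inv a \<otimes> b) = b"
  using assms by (simp_all flip: m_assoc)

text \<open>B. H. Neumann's lemma. Induction on the number of subgroups: if \<open>H\<close> has infinite index, some
  coset \<open>x <#\<^bsub>G\<^esub> H\<close> is not among the given ones, so it is covered by cosets of the other subgroups.
  Translates of that covering then replace every coset of \<open>H\<close>.\<close>

lemma finite_coset_cover_imp_finite_index:
  assumes "finite \<H>" and "\<And>H. H \<in> \<H> \<Longrightarrow> subgroup H G"
    and "finite P" and "P \<subseteq> carrier G \<times> \<H>"
    and "carrier G \<subseteq> (\<Union>(g, H)\<in>P. g <#\<^bsub>G\<^esub> H)"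
  shows "\<exists>H\<in>\<H>. finite (lcosets H)"
  using assms
proof (induction \<H> arbitrary: P)
  case empty
  then show ?case by auto
next
  case (insert H \<H>)
  have H: "subgroup H G"
    using insert.prems by auto
  show ?case
  proof (cases "finite (lcosets H)")
    case True
    then show ?thesis by auto
  next
    case False
    have "finite ((\<lambda>(g, K). g <#\<^bsub>G\<^esub> K) ` P)"
      using insert.prems by auto
    then have "\<not> lcosets H \<subseteq> (\<lambda>(g, K). g <#\<^bsub>G\<^esub> K) ` P"
      using False finite_subset by blast
    then obtain x where x: "x \<in> carrier G" "x <#\<^bsub>G\<^esub> H \<notin> (\<lambda>(g, K). g <#\<^bsub>G\<^esub> K) ` P"
      unfolding LCOSETS_def by blast
    \<comment> \<open>\<open>Q\<close> covers \<open>x <# H\<close>, and \<open>g <# H\<close> is the translate of \<open>x <# H\<close> by \<open>g \<otimes> inv x\<close>.\<close>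
    define Q where "Q = {(k, K) \<in> P. K \<noteq> H}"
    define P' where "P' = Q \<union> (\<lambda>((g, _), (k, K)). (g \<otimes> inv x \<otimes> k, K)) ` (P \<times> Q)"
    have Q: "x \<otimes> h \<in> (\<Union>(k, K)\<in>Q. k <#\<^bsub>G\<^esub> K)" if h: "h \<in> H" for h
    proof -
      have xh: "x \<otimes> h \<in> x <#\<^bsub>G\<^esub> H" "x \<otimes> h \<in> carrier G"
        using h x(1) subgroup.subset[OF H] by (auto simp: l_coset_def)
      then obtain k K where k: "(k, K) \<in> P" "x \<otimes> h \<in> k <#\<^bsub>G\<^esub> K"
        using insert.prems(4) by blast
      have "K \<noteq> H"
      proof
        assume "K = H"
        then have "k <#\<^bsub>G\<^esub> K = x <#\<^bsub>G\<^esub> H"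
          using k xh(1) x(1) insert.prems(3) l_repr_independence[OF _ _ H] by (metis SigmaD1 subsetD)
        with k(1) x(2) show False by (metis (mono_tags, lifting) case_prod_conv image_eqI)
      qed
      with k show ?thesis by (auto simp: Q_def)
    qed
    have "carrier G \<subseteq> (\<Union>(g, K)\<in>P'. g <#\<^bsub>G\<^esub> K)"
    proof
      fix y assume y: "y \<in> carrier G"
      then obtain g K where g: "(g, K) \<in> P" "y \<in> g <#\<^bsub>G\<^esub> K"
        using insert.prems(4) by blast
      show "y \<in> (\<Union>(g, K)\<in>P'. g <#\<^bsub>G\<^esub> K)"
      proof (cases "K = H")
        case False
        with g show ?thesis by (auto simp: P'_def Q_def)
      next
        case True
        with g obtain h where h: "h \<in> H" "y = g \<otimes> h"
          by (auto simp: l_coset_def)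
        obtain k L where k: "(k, L) \<in> Q" "x \<otimes> h \<in> k <#\<^bsub>G\<^esub> L"
          using Q[OF h(1)] by blast
        then obtain l where l: "l \<in> L" "x \<otimes> h = k \<otimes> l"
          by (auto simp: l_coset_def)
        have kL: "(k, L) \<in> P"
          using k(1) by (auto simp: Q_def)
        then have "subgroup L G"
          using insert.prems(1,3) by blast
        then have car: "g \<in> carrier G" "k \<in> carrier G" "h \<in> carrier G" "l \<in> carrier G"
          using g(1) kL insert.prems(3) h(1) l(1) subgroup.subset[OF H] subgroup.subset[of L G] by blast+
        have "y = g \<otimes> inv x \<otimes> (x \<otimes> h)"
          using car x(1) h(2) by (simp add: m_assoc)
        also have "\<dots> = (g \<otimes> inv x \<otimes> k) \<otimes> l"
          using car x(1) l(2) by (simp add: m_assoc)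
        finally have "y \<in> (g \<otimes> inv x \<otimes> k) <#\<^bsub>G\<^esub> L"
          using l(1) by (auto simp: l_coset_def)
        moreover have "(g \<otimes> inv x \<otimes> k, L) \<in> P'"
          unfolding P'_def using g(1) k(1) by force
        ultimately show ?thesis by blast
      qed
    qed
    moreover have "P' \<subseteq> carrier G \<times> \<H>"
      using insert.prems(3) x(1) by (auto simp: P'_def Q_def)
    moreover have "finite P'"
      using insert.prems(2) finite_subset[of Q P] by (auto simp: P'_def Q_def)
    ultimately have "\<exists>H\<in>\<H>. finite (lcosets H)"
      using insert.prems(1) insert.IH[of P'] by auto
    then show ?thesis by auto
  qed
qed

lemma conj_conj:
  assumes "g \<in> carrier G" "h \<in> carrier G" "x \<in> carrier G"
  shows "inv (g \<otimes> h) \<otimes> x \<otimes> (g \<otimes> h) = inv h \<otimes> (inv g \<otimes> x \<otimes> g) \<otimes> h"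
  using assms by (simp add: inv_mult_group m_assoc)

lemma conj_eq_iff:
  assumes "s \<in> carrier G" "x \<in> carrier G" "y \<in> carrier G"
  shows "inv s \<otimes> x \<otimes> s = y \<longleftrightarrow> x = s \<otimes> y \<otimes> inv s"
  using assms by (metis inv_closed inv_inv inv_solve_left inv_solve_right m_assoc m_closed)

lemma FC_iff:
  "t \<in> FC G \<longleftrightarrow> t \<in> carrier G \<and> finite ((\<lambda>s. inv s \<otimes> t \<otimes> s) ` carrier G)"
proof -
  have "m_inv G ` carrier G = carrier G"
    by (force intro!: image_eqI[where x = "inv _"])
  then have "(\<lambda>s. inv s \<otimes> t \<otimes> s) ` carrier G = (\<lambda>s. inv s \<otimes> t \<otimes> s) ` m_inv G ` carrier G"
    by simp
  also have "\<dots> = {s \<otimes> t \<otimes> inv s |s. s \<in> carrier G}"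
    by (auto simp: image_image)
  finally show ?thesis by (simp add: FC_def)
qed

lemma normal_FC: "FC G \<lhd> G"
proof -
  have conj: "inv s \<otimes> t \<otimes> s \<in> FC G" if s: "s \<in> carrier G" and t: "t \<in> FC G" for s t
  proof -
    have "(\<lambda>r. inv r \<otimes> (inv s \<otimes> t \<otimes> s) \<otimes> r) ` carrier G \<subseteq> (\<lambda>r. inv r \<otimes> t \<otimes> r) ` carrier G"
      using s t by (auto simp: FC_iff simp flip: conj_conj)
    with s t show ?thesis
      by (auto simp: FC_iff intro: finite_subset)
  qed
  have "subgroup (FC G) G"
  proof (rule subgroupI)
    have "(\<lambda>s. inv s \<otimes> \<one> \<otimes> s) ` carrier G \<subseteq> {\<one>}"
      by auto
    then have "\<one> \<in> FC G"
      by (auto simp: FC_iff intro: finite_subset)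
    then show "FC G \<noteq> {}" by auto
  next
    fix a assume a: "a \<in> FC G"
    have "inv s \<otimes> inv a \<otimes> s = inv (inv s \<otimes> a \<otimes> s)" if "s \<in> carrier G" for s
      using a that by (simp add: FC_iff inv_mult_group m_assoc)
    then have "(\<lambda>s. inv s \<otimes> inv a \<otimes> s) ` carrier G = m_inv G ` (\<lambda>s. inv s \<otimes> a \<otimes> s) ` carrier G"
      by (auto simp: image_image)
    with a show "inv a \<in> FC G" by (simp add: FC_iff)
  next
    fix a b assume a: "a \<in> FC G" and b: "b \<in> FC G"
    let ?C = "\<lambda>t. (\<lambda>s. inv s \<otimes> t \<otimes> s) ` carrier G"
    have "inv s \<otimes> (a \<otimes> b) \<otimes> s = (inv s \<otimes> a \<otimes> s) \<otimes> (inv s \<otimes> b \<otimes> s)" if "s \<in> carrier G" for s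
      using a b that by (simp add: FC_iff m_assoc)
    then have "?C (a \<otimes> b) \<subseteq> (\<lambda>(x, y). x \<otimes> y) ` (?C a \<times> ?C b)"
      by force
    moreover have "finite ((\<lambda>(x, y). x \<otimes> y) ` (?C a \<times> ?C b))"
      using a b by (simp add: FC_iff)
    ultimately have "finite (?C (a \<otimes> b))"
      by (rule finite_subset)
    with a b show "a \<otimes> b \<in> FC G" by (simp add: FC_iff)
  qed (auto simp: FC_iff)
  moreover have "s \<otimes> t \<otimes> inv s \<in> FC G" if "s \<in> carrier G" "t \<in> FC G" for s t
    using conj[of "inv s" t] that by simp
  ultimately show ?thesis
    by (simp add: normal_inv_iff)
qed

text \<open>The conjugate of \<open>y\<close> by \<open>s\<close> depends only on the left coset of \<open>s\<close> modulo the centralizer, so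
  there are at least as many cosets as conjugates.\<close>

lemma infinite_index_centralizer:
  assumes y: "y \<in> carrier G - FC G"
  defines "C \<equiv> {c \<in> carrier G. c \<otimes> y = y \<otimes> c}"
  shows "subgroup C G" and "infinite (lcosets C)"
proof -
  show sub: "subgroup C G"
  proof (rule subgroupI)
    show "C \<noteq> {}" using y by (auto simp: C_def intro: exI[of _ \<one>])
  next
    fix a assume "a \<in> C"
    with y show "inv a \<in> C"
      by (auto simp: C_def) (metis inv_closed inv_solve_left inv_solve_right m_assoc m_closed)
  next
    fix a b assume "a \<in> C" "b \<in> C"
    with y show "a \<otimes> b \<in> C"
      by (auto simp: C_def) (metis m_assoc)
  qed (auto simp: C_def)
  show "infinite (lcosets C)"
  proof
    assume fin: "finite (lcosets C)"
    have "finite ((\<lambda>s. s \<otimes> y \<otimes> inv s) ` X)" if X: "X \<in> lcosets C" for X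
    proof -
      from X obtain a where a: "a \<in> carrier G" "X = a <#\<^bsub>G\<^esub> C"
        by (auto simp: LCOSETS_def)
      have "(a \<otimes> c) \<otimes> y \<otimes> inv (a \<otimes> c) = a \<otimes> y \<otimes> inv a" if c: "c \<in> C" for c
      proof -
        have "(a \<otimes> c) \<otimes> y \<otimes> inv (a \<otimes> c) = a \<otimes> (c \<otimes> y) \<otimes> inv c \<otimes> inv a"
          using a(1) c y by (simp add: C_def inv_mult_group m_assoc)
        also have "\<dots> = a \<otimes> y \<otimes> inv a"
          using a(1) c y by (simp add: C_def m_assoc)
        finally show ?thesis .
      qed
      then have "(\<lambda>s. s \<otimes> y \<otimes> inv s) ` X \<subseteq> {a \<otimes> y \<otimes> inv a}"
        using a(2) by (auto simp: l_coset_def)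
      then show ?thesis
        by (rule finite_subset) simp
    qed
    with fin have "finite (\<Union>X\<in>lcosets C. (\<lambda>s. s \<otimes> y \<otimes> inv s) ` X)"
      by blast
    moreover have "(\<Union>X\<in>lcosets C. (\<lambda>s. s \<otimes> y \<otimes> inv s) ` X) = {s \<otimes> y \<otimes> inv s |s. s \<in> carrier G}"
      using lcosets_part_G[OF sub] by blast
    ultimately show False
      using y by (simp add: FC_def)
  qed
qed

text \<open>The elements that conjugate a given \<open>x\<close> to a given \<open>y\<close> form a coset of the centralizer of
  \<open>y\<close>, which has infinite index. By Neumann's lemma finitely many such cosets do not exhaust the
  group.\<close>

lemma exists_conj_disjoint:
  assumes "finite K" "K \<subseteq> carrier G - FC G" and "finite L" "L \<subseteq> carrier G - FC G"
  shows "\<exists>g\<in>carrier G. \<forall>x\<in>K. inv g \<otimes> x \<otimes> g \<notin> L"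
proof (rule ccontr)
  assume contra: "\<not> ?thesis"
  define C where "C y = {c \<in> carrier G. c \<otimes> y = y \<otimes> c}" for y
  define P where "P = {(x, y) \<in> K \<times> L. \<exists>g\<in>carrier G. inv g \<otimes> x \<otimes> g = y}"
  have "\<exists>c. \<forall>p\<in>P. c p \<in> carrier G \<and> inv c p \<otimes> fst p \<otimes> c p = snd p"
    by (intro bchoice) (auto simp: P_def)
  then obtain c where c: "c p \<in> carrier G" "inv c p \<otimes> fst p \<otimes> c p = snd p" if "p \<in> P" for p
    by blast
  have "\<exists>H\<in>C ` L. finite (lcosets H)"
  proof (rule finite_coset_cover_imp_finite_index)
    show "subgroup H G" if "H \<in> C ` L" for H
      using that assms(4) infinite_index_centralizer(1) by (auto simp: C_def)
    show "finite ((\<lambda>p. (c p, C (snd p))) ` P)"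
      using assms(1,3) finite_subset[of P "K \<times> L"] by (auto simp: P_def)
    show "(\<lambda>p. (c p, C (snd p))) ` P \<subseteq> carrier G \<times> C ` L"
      using c(1) by (auto simp: P_def)
    show "carrier G \<subseteq> (\<Union>(g, H)\<in>(\<lambda>p. (c p, C (snd p))) ` P. g <#\<^bsub>G\<^esub> H)"
    proof
      fix g assume g: "g \<in> carrier G"
      with contra obtain x where x: "x \<in> K" "inv g \<otimes> x \<otimes> g \<in> L" by blast
      define y where "y = inv g \<otimes> x \<otimes> g"
      define k where "k = c (x, y)"
      have xy: "(x, y) \<in> P"
        using x g by (auto simp: P_def y_def)
      have k: "k \<in> carrier G" "inv k \<otimes> x \<otimes> k = y" and car: "x \<in> carrier G" "y \<in> carrier G"
        using c[OF xy] x g assms(2) by (auto simp: k_def y_def)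
      have "inv k \<otimes> g \<otimes> y = inv k \<otimes> x \<otimes> g"
        using k(1) car g by (simp add: y_def m_assoc)
      also have "\<dots> = y \<otimes> (inv k \<otimes> g)"
        using k(1) car g by (simp add: k(2)[symmetric] m_assoc)
      finally have "inv k \<otimes> g \<in> C y"
        using k(1) g by (simp add: C_def)
      moreover have "g = k \<otimes> (inv k \<otimes> g)"
        using k(1) g by simp
      ultimately have "g \<in> k <#\<^bsub>G\<^esub> C y"
        by (auto simp: l_coset_def)
      with xy show "g \<in> (\<Union>(g, H)\<in>(\<lambda>p. (c p, C (snd p))) ` P. g <#\<^bsub>G\<^esub> H)"
        by (force simp: k_def)
    qed
  qed (use assms in auto)
  then show False
    using assms(4) infinite_index_centralizer(2) by (auto simp: C_def)
qed

text \<open>Since \<open>F\<close> has only finitely many images under conjugation, every \<open>g\<close> agrees on \<open>F\<close> with one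
  of finitely many elements \<open>r\<close>, and then \<open>g \<otimes> inv r\<close> centralizes \<open>F\<close>. It therefore suffices that
  \<open>g\<close> moves \<open>K\<close> off all the conjugates \<open>inv r \<otimes> K \<otimes> r\<close>.\<close>

lemma exists_centralizing_displacement:
  assumes "finite F" "F \<subseteq> FC G" and "finite K" "K \<subseteq> carrier G - FC G"
  shows "\<exists>s\<in>carrier G. (\<forall>x\<in>F. inv s \<otimes> x \<otimes> s = x) \<and> (\<forall>x\<in>K. inv s \<otimes> x \<otimes> s \<notin> K)"
proof -
  interpret FC: normal "FC G" G by (rule normal_FC)
  define act where "act s = (\<lambda>x\<in>F. inv s \<otimes> x \<otimes> s)" for s
  define R where "R = inv_into (carrier G) act ` act ` carrier G"
  have R: "R \<subseteq> carrier G"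
    by (auto simp: R_def intro: inv_into_into)
  have "act ` carrier G \<subseteq> (\<Pi>\<^sub>E x\<in>F. (\<lambda>s. inv s \<otimes> x \<otimes> s) ` carrier G)"
    by (auto simp: act_def)
  moreover have "finite (\<Pi>\<^sub>E x\<in>F. (\<lambda>s. inv s \<otimes> x \<otimes> s) ` carrier G)"
  proof (rule finite_PiE[OF assms(1)])
    show "finite ((\<lambda>s. inv s \<otimes> x \<otimes> s) ` carrier G)" if "x \<in> F" for x
      using subsetD[OF assms(2) that] unfolding FC_iff by (rule conjunct2)
  qed
  ultimately have "finite (act ` carrier G)"
    by (rule finite_subset)
  then have "finite R"
    by (simp add: R_def)
  define L where "L = (\<Union>r\<in>R. (\<lambda>x. inv r \<otimes> x \<otimes> r) ` K)"
  have "L \<subseteq> carrier G - FC G"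
  proof
    fix y assume "y \<in> L"
    then obtain r x where r: "r \<in> R" and x: "x \<in> K" "y = inv r \<otimes> x \<otimes> r"
      by (auto simp: L_def)
    have car: "r \<in> carrier G" "x \<in> carrier G" "y \<in> carrier G" "x \<notin> FC G"
      using r x R assms(4) by auto
    then have "x = r \<otimes> y \<otimes> inv r"
      using x(2) conj_eq_iff by metis
    then show "y \<in> carrier G - FC G"
      using car FC.inv_op_closed2[of r y] by auto
  qed
  moreover have "finite L"
    using \<open>finite R\<close> assms(3) by (simp add: L_def)
  ultimately have "\<exists>g\<in>carrier G. \<forall>x\<in>K. inv g \<otimes> x \<otimes> g \<notin> L"
    using exists_conj_disjoint[OF assms(3,4)] by metis
  then obtain g where g: "g \<in> carrier G" "\<And>x. x \<in> K \<Longrightarrow> inv g \<otimes> x \<otimes> g \<notin> L"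
    by metis
  define r where "r = inv_into (carrier G) act (act g)"
  have r: "r \<in> R" "r \<in> carrier G" "act r = act g"
    using g(1) R by (auto simp: r_def R_def intro: f_inv_into_f)
  have car: "F \<subseteq> carrier G" "K \<subseteq> carrier G"
    using assms(2,4) FC.subset by auto
  have s: "inv (g \<otimes> inv r) \<otimes> x \<otimes> (g \<otimes> inv r) = r \<otimes> (inv g \<otimes> x \<otimes> g) \<otimes> inv r"
    if "x \<in> carrier G" for x
    using conj_conj[of g "inv r" x] that g(1) r(2) by simp
  have fix_F: "inv (g \<otimes> inv r) \<otimes> x \<otimes> (g \<otimes> inv r) = x" if x: "x \<in> F" for x
  proof -
    have xc: "x \<in> carrier G"
      using x car(1) by (rule subsetD[rotated])
    have "inv r \<otimes> x \<otimes> r = inv g \<otimes> x \<otimes> g"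
      using fun_cong[OF r(3), of x] x by (simp add: act_def)
    then have "inv (g \<otimes> inv r) \<otimes> x \<otimes> (g \<otimes> inv r) = r \<otimes> (inv r \<otimes> x \<otimes> r) \<otimes> inv r"
      using s[OF xc] by simp
    also have "\<dots> = x"
      using xc r(2) by (simp add: m_assoc)
    finally show ?thesis .
  qed
  have move_K: "inv (g \<otimes> inv r) \<otimes> x \<otimes> (g \<otimes> inv r) \<notin> K" if x: "x \<in> K" for x
  proof
    assume K: "inv (g \<otimes> inv r) \<otimes> x \<otimes> (g \<otimes> inv r) \<in> K"
    have xc: "x \<in> carrier G"
      using x car(2) by (rule subsetD[rotated])
    have "inv r \<otimes> (inv (g \<otimes> inv r) \<otimes> x \<otimes> (g \<otimes> inv r)) \<otimes> r = inv g \<otimes> x \<otimes> g"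
      unfolding s[OF xc] using xc g(1) r(2) by (simp add: m_assoc)
    then have "inv g \<otimes> x \<otimes> g \<in> (\<lambda>x. inv r \<otimes> x \<otimes> r) ` K"
      using imageI[OF K, of "\<lambda>x. inv r \<otimes> x \<otimes> r"] by (rule subst)
    with r(1) have "inv g \<otimes> x \<otimes> g \<in> L"
      unfolding L_def by (rule UN_I)
    with g(2)[OF x] show False ..
  qed
  show ?thesis
    using fix_F move_K g(1) r(2) by (intro bexI[of _ "g \<otimes> inv r"]) simp_all
qed

end

section \<open>Weak*-convergence of bounded nets\<close>

lemma l1_norm_nonneg: "l1_norm G f \<ge> 0"
  by (simp add: l1_norm_def infsum_nonneg)

lemma zero_in_l1: "(\<lambda>_. 0) \<in> l1 G"
  by (simp add: l1_def)

lemma l1_diff: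
  assumes "f \<in> l1 G" "g \<in> l1 G"
  shows "(\<lambda>x. f x - g x) \<in> l1 G"
  using l1_add[OF assms(1) l1_scale[OF assms(2), of "-1"]] by simp

lemma l1_sum:
  assumes "\<And>i. i \<in> S \<Longrightarrow> u i \<in> l1 G"
  shows "(\<lambda>x. \<Sum>i\<in>S. u i x) \<in> l1 G"
  using assms by (induction S rule: infinite_finite_induct) (auto simp: zero_in_l1 intro: l1_add)

lemma l1_norm_add:
  assumes "f \<in> l1 G" "g \<in> l1 G"
  shows "l1_norm G (\<lambda>x. f x + g x) \<le> l1_norm G f + l1_norm G g"
proof -
  have "l1_norm G (\<lambda>x. f x + g x) \<le> (\<Sum>\<^sub>\<infinity>x\<in>carrier G. norm (f x) + norm (g x))"
    unfolding l1_norm_def using assms l1_add[OF assms]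
    by (intro infsum_mono summable_on_add) (auto simp: l1_def norm_triangle_ineq)
  also have "\<dots> = l1_norm G f + l1_norm G g"
    unfolding l1_norm_def using assms by (intro infsum_add) (auto simp: l1_def)
  finally show ?thesis .
qed

lemma l1_norm_scale: "l1_norm G (\<lambda>x. c * f x) = norm c * l1_norm G f"
  by (simp add: l1_norm_def norm_mult infsum_cmult_right')

lemma l1_norm_diff:
  assumes "f \<in> l1 G" "g \<in> l1 G"
  shows "l1_norm G (\<lambda>x. f x - g x) \<le> l1_norm G f + l1_norm G g"
  using l1_norm_add[OF assms(1) l1_scale[OF assms(2), of "-1"]] l1_norm_scale[of G "-1" g] by simp

lemma l1_norm_sum:
  assumes "\<And>i. i \<in> S \<Longrightarrow> u i \<in> l1 G"
  shows "l1_norm G (\<lambda>x. \<Sum>i\<in>S. u i x) \<le> (\<Sum>i\<in>S. l1_norm G (u i))"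
  using assms
proof (induction S rule: infinite_finite_induct)
  case (insert i S)
  then have "l1_norm G (\<lambda>x. u i x + (\<Sum>i\<in>S. u i x)) \<le> l1_norm G (u i) + l1_norm G (\<lambda>x. \<Sum>i\<in>S. u i x)"
    by (intro l1_norm_add l1_sum) auto
  with insert show ?case by auto
qed (auto simp: l1_norm_def)

lemma c0_bounded:
  assumes "h \<in> c0 G"
  obtains B where "\<And>x. norm (h x) \<le> B"
proof -
  define A where "A = {x \<in> carrier G. norm (h x) \<ge> 1}"
  have A: "finite A"
    using assms by (auto simp: A_def c0_def)
  have "norm (h x) \<le> 1 + (\<Sum>x\<in>A. norm (h x))" for x
  proof (cases "x \<in> A")
    case True
    then have "norm (h x) \<le> (\<Sum>x\<in>A. norm (h x))"
      using A by (intro member_le_sum) auto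
    then show ?thesis by simp
  next
    case False
    then have "norm (h x) \<le> 1"
      using assms by (cases "x \<in> carrier G") (auto simp: A_def c0_def)
    then show ?thesis
      by (smt (verit) norm_ge_zero sum_nonneg)
  qed
  then show thesis by (rule that)
qed

lemma l1_c0_abs_summable:
  assumes "f \<in> l1 G" "h \<in> c0 G"
  shows "(\<lambda>x. norm (f x * h x)) summable_on carrier G"
proof -
  obtain B where B: "\<And>x. norm (h x) \<le> B"
    using c0_bounded[OF assms(2)] by metis
  have "(\<lambda>x. norm (f x) * B) summable_on carrier G"
    using assms(1) by (auto simp: l1_def intro: summable_on_cmult_left)
  then show ?thesis
    by (rule summable_on_comparison_test) (auto simp: norm_mult intro: mult_left_mono B)
qed

lemmas l1_c0_summable = Infinite_Sum.abs_summable_summable[OF l1_c0_abs_summable]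

text \<open>Off a finite set \<open>h\<close> is small, so a norm bound controls the pairing there; on the finite set
  pointwise convergence does.\<close>

lemma tendsto_pairing:
  assumes h: "h \<in> c0 G" and f: "f \<in> l1 G"
    and u: "\<forall>\<^sub>F i in F. u i \<in> l1 G \<and> l1_norm G (u i) \<le> M"
    and ptw: "\<And>x. x \<in> carrier G \<Longrightarrow> ((\<lambda>i. u i x) \<longlongrightarrow> f x) F"
  shows "((\<lambda>i. \<Sum>\<^sub>\<infinity>x\<in>carrier G. u i x * h x) \<longlongrightarrow> (\<Sum>\<^sub>\<infinity>x\<in>carrier G. f x * h x)) F"
proof (rule tendstoI)
  fix e :: real assume e: "e > 0"
  \<comment> \<open>\<open>C\<close> bounds the norm of \<open>u i - f\<close>; the \<open>1\<close> makes it positive.\<close>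
  define C where "C = \<bar>M\<bar> + l1_norm G f + 1"
  have C: "C > 0"
    using l1_norm_nonneg[of G f] by (simp add: C_def)
  define \<eta> where "\<eta> = e / (2 * C)"
  have \<eta>: "\<eta> > 0" "\<eta> * C = e / 2"
    using e C by (simp_all add: \<eta>_def)
  define A where "A = {x \<in> carrier G. norm (h x) \<ge> \<eta>}"
  have A: "finite A" "A \<subseteq> carrier G"
    using h \<eta> by (auto simp: A_def c0_def)
  have "((\<lambda>i. \<Sum>x\<in>A. norm (u i x - f x) * norm (h x)) \<longlongrightarrow> (\<Sum>x\<in>A. norm (f x - f x) * norm (h x))) F"
    using A by (intro tendsto_intros ptw) auto
  then have "((\<lambda>i. \<Sum>x\<in>A. norm (u i x - f x) * norm (h x)) \<longlongrightarrow> 0) F"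
    by simp
  then have "\<forall>\<^sub>F i in F. (\<Sum>x\<in>A. norm (u i x - f x) * norm (h x)) < e / 2"
    using e by (intro order_tendstoD(2)[of _ 0]) auto
  with u show "\<forall>\<^sub>F i in F. dist (\<Sum>\<^sub>\<infinity>x\<in>carrier G. u i x * h x) (\<Sum>\<^sub>\<infinity>x\<in>carrier G. f x * h x) < e"
  proof eventually_elim
    case (elim i)
    define g where "g = (\<lambda>x. u i x - f x)"
    have ui: "u i \<in> l1 G" "l1_norm G (u i) \<le> M"
      using elim by auto
    have g: "g \<in> l1 G"
      unfolding g_def using ui f by (intro l1_diff) auto
    have gC: "l1_norm G g \<le> C"
      unfolding g_def using l1_norm_diff[OF ui(1) f] ui(2) by (simp add: C_def)
    have sum_A: "(\<lambda>x. (if x \<in> A then norm (g x) * norm (h x) else 0)) summable_on carrier G"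
      "(\<Sum>\<^sub>\<infinity>x\<in>carrier G. if x \<in> A then norm (g x) * norm (h x) else 0) = (\<Sum>x\<in>A. norm (g x) * norm (h x))"
    proof -
      have "((\<lambda>x. if x \<in> A then norm (g x) * norm (h x) else 0) has_sum (\<Sum>x\<in>A. norm (g x) * norm (h x))) (carrier G)
          \<longleftrightarrow> ((\<lambda>x. norm (g x) * norm (h x)) has_sum (\<Sum>x\<in>A. norm (g x) * norm (h x))) A"
        using A by (intro has_sum_cong_neutral) auto
      then have "((\<lambda>x. if x \<in> A then norm (g x) * norm (h x) else 0) has_sum (\<Sum>x\<in>A. norm (g x) * norm (h x))) (carrier G)"
        using has_sum_finite[OF A(1)] by blast
      then show "(\<lambda>x. (if x \<in> A then norm (g x) * norm (h x) else 0)) summable_on carrier G"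
        "(\<Sum>\<^sub>\<infinity>x\<in>carrier G. if x \<in> A then norm (g x) * norm (h x) else 0) = (\<Sum>x\<in>A. norm (g x) * norm (h x))"
        by (auto intro: has_sum_imp_summable infsumI)
    qed
    have sum_\<eta>: "(\<lambda>x. \<eta> * norm (g x)) summable_on carrier G"
      using g by (auto simp: l1_def intro: summable_on_cmult_right)
    have "(\<Sum>\<^sub>\<infinity>x\<in>carrier G. u i x * h x) = (\<Sum>\<^sub>\<infinity>x\<in>carrier G. g x * h x + f x * h x)"
      by (simp add: g_def algebra_simps)
    also have "\<dots> = (\<Sum>\<^sub>\<infinity>x\<in>carrier G. g x * h x) + (\<Sum>\<^sub>\<infinity>x\<in>carrier G. f x * h x)"
      using g f h by (intro infsum_add l1_c0_summable)
    finally have "dist (\<Sum>\<^sub>\<infinity>x\<in>carrier G. u i x * h x) (\<Sum>\<^sub>\<infinity>x\<in>carrier G. f x * h x) = norm (\<Sum>\<^sub>\<infinity>x\<in>carrier G. g x * h x)"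
      by (simp add: dist_norm)
    also have "\<dots> \<le> (\<Sum>\<^sub>\<infinity>x\<in>carrier G. norm (g x * h x))"
      by (rule norm_infsum_bound[OF l1_c0_abs_summable[OF g h]])
    also have "\<dots> \<le> (\<Sum>\<^sub>\<infinity>x\<in>carrier G. (if x \<in> A then norm (g x) * norm (h x) else 0) + \<eta> * norm (g x))"
    proof (rule infsum_mono[OF l1_c0_abs_summable[OF g h] summable_on_add[OF sum_A(1) sum_\<eta>]])
      fix x assume "x \<in> carrier G"
      then have "norm (h x) \<le> \<eta>" if "x \<notin> A"
        using that by (auto simp: A_def)
      then show "norm (g x * h x) \<le> (if x \<in> A then norm (g x) * norm (h x) else 0) + \<eta> * norm (g x)"
        using \<eta>(1) by (auto simp: norm_mult mult.commute[of \<eta>] intro: mult_left_mono)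
    qed
    also have "\<dots> = (\<Sum>x\<in>A. norm (g x) * norm (h x)) + \<eta> * l1_norm G g"
      using sum_A sum_\<eta> by (simp add: infsum_add l1_norm_def infsum_cmult_right')
    also have "\<dots> < e / 2 + \<eta> * C"
      using elim gC \<eta>(1) by (intro add_less_le_mono mult_left_mono) (auto simp: g_def)
    finally show ?case
      using \<eta>(2) by simp
  qed
qed

lemma limitin_weak_star:
  assumes "f \<in> l1 G" and "\<forall>\<^sub>F i in F. u i \<in> l1 G \<and> l1_norm G (u i) \<le> M"
    and "\<And>x. x \<in> carrier G \<Longrightarrow> ((\<lambda>i. u i x) \<longlongrightarrow> f x) F"
  shows "limitin (weak_star G) u f F"
  unfolding limitin_def topspace_weak_star
proof (intro conjI allI impI)
  fix U assume U: "openin (weak_star G) U \<and> f \<in> U"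
  then have "generate_topology_on {{f \<in> l1 G. (\<Sum>\<^sub>\<infinity>x\<in>carrier G. f x * h x) \<in> V} |h V. h \<in> c0 G \<and> open V} U"
    unfolding weak_star_def by (auto intro: openin_topology_generated_by)
  then have "f \<in> U \<longrightarrow> (\<forall>\<^sub>F i in F. u i \<in> U)"
  proof induction
    case (Int U V)
    then show ?case by (auto intro: eventually_conj)
  next
    case (UN K)
    then show ?case by (fastforce elim: eventually_mono)
  next
    case (Basis s)
    then obtain h V where h: "h \<in> c0 G" and V: "open V"
      and s: "s = {f \<in> l1 G. (\<Sum>\<^sub>\<infinity>x\<in>carrier G. f x * h x) \<in> V}"
      by blast
    show ?case
    proof
      assume "f \<in> s"
      then have "\<forall>\<^sub>F i in F. (\<Sum>\<^sub>\<infinity>x\<in>carrier G. u i x * h x) \<in> V"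
        using s V by (intro topological_tendstoD[OF tendsto_pairing[OF h assms]]) auto
      with assms(2) show "\<forall>\<^sub>F i in F. u i \<in> s"
        by eventually_elim (simp add: s)
    qed
  qed simp
  with U show "\<forall>\<^sub>F i in F. u i \<in> U" by blast
qed (rule assms(1))

lemma weak_star_closed_bounded_limit:
  assumes "closedin (weak_star G) I" and "F \<noteq> bot"
    and "\<forall>\<^sub>F i in F. u i \<in> I" and "\<forall>\<^sub>F i in F. l1_norm G (u i) \<le> M"
    and "f \<in> l1 G" and "\<And>x. x \<in> carrier G \<Longrightarrow> ((\<lambda>i. u i x) \<longlongrightarrow> f x) F"
  shows "f \<in> I"
proof (rule limitin_closedin)
  have "I \<subseteq> l1 G"
    using assms(1) closedin_subset by fastforce
  then have "\<forall>\<^sub>F i in F. u i \<in> l1 G \<and> l1_norm G (u i) \<le> M"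
    using eventually_conj[OF assms(3,4)] by (auto elim: eventually_mono)
  then show "limitin (weak_star G) u f F"
    using assms(5,6) by (intro limitin_weak_star)
qed (use assms in auto)

text \<open>A map dual to a map between the predual spaces is weak*-continuous.\<close>

lemma continuous_map_weak_star:
  assumes "\<And>f. f \<in> l1 G \<Longrightarrow> \<phi> f \<in> l1 H"
    and "\<And>h. h \<in> c0 H \<Longrightarrow> \<exists>k\<in>c0 G. \<forall>f\<in>l1 G.
      (\<Sum>\<^sub>\<infinity>x\<in>carrier H. \<phi> f x * h x) = (\<Sum>\<^sub>\<infinity>x\<in>carrier G. f x * k x)"
  shows "continuous_map (weak_star G) (weak_star H) \<phi>"
  unfolding weak_star_def[of H]
proof (rule continuous_on_generated_topo)
  let ?B = "{{f \<in> l1 H. (\<Sum>\<^sub>\<infinity>x\<in>carrier H. f x * h x) \<in> U} |h U. h \<in> c0 H \<and> open U}"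
  have "\<Union>?B = l1 H"
    using topspace_weak_star[of H] unfolding weak_star_def topology_generated_by_topspace .
  then show "\<phi> ` topspace (weak_star G) \<subseteq> \<Union>?B"
    using assms(1) by auto
  fix V assume "V \<in> ?B"
  then obtain h U where h: "h \<in> c0 H" and U: "open U"
    and V: "V = {f \<in> l1 H. (\<Sum>\<^sub>\<infinity>x\<in>carrier H. f x * h x) \<in> U}"
    by blast
  obtain k where k: "k \<in> c0 G" "\<And>f. f \<in> l1 G \<Longrightarrow>
      (\<Sum>\<^sub>\<infinity>x\<in>carrier H. \<phi> f x * h x) = (\<Sum>\<^sub>\<infinity>x\<in>carrier G. f x * k x)"
    using assms(2)[OF h] by blast
  have "\<phi> -` V \<inter> topspace (weak_star G) = {f \<in> l1 G. (\<Sum>\<^sub>\<infinity>x\<in>carrier G. f x * k x) \<in> U}"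
    using k(2) assms(1) by (auto simp: V)
  also have "openin (weak_star G) \<dots>"
    unfolding weak_star_def using k(1) U by (intro topology_generated_by_Basis) blast
  finally show "openin (weak_star G) (\<phi> -` V \<inter> topspace (weak_star G))" .
qed

text \<open>The net \<open>u\<close> converges to \<open>f\<close> in norm, hence pointwise, and is eventually bounded.\<close>

lemma weak_star_closed_norm_limit:
  assumes G: "group G" and I: "closedin (weak_star G) I" and "F \<noteq> bot"
    and u: "\<forall>\<^sub>F i in F. u i \<in> I" and f: "f \<in> l1 G"
    and lim: "((\<lambda>i. l1_norm G (\<lambda>x. f x - u i x)) \<longlongrightarrow> 0) F"
  shows "f \<in> I"
proof (rule weak_star_closed_bounded_limit[OF I \<open>F \<noteq> bot\<close> u _ f])
  have "I \<subseteq> l1 G"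
    using I closedin_subset by fastforce
  with u have ul: "\<forall>\<^sub>F i in F. u i \<in> l1 G"
    by (auto elim: eventually_mono)
  have "\<forall>\<^sub>F i in F. l1_norm G (\<lambda>x. f x - u i x) < 1"
    using lim by (rule order_tendstoD) simp
  with ul show "\<forall>\<^sub>F i in F. l1_norm G (u i) \<le> l1_norm G f + 1"
  proof eventually_elim
    case (elim i)
    have "l1_norm G (\<lambda>x. f x - (f x - u i x)) \<le> l1_norm G f + l1_norm G (\<lambda>x. f x - u i x)"
      using f elim by (intro l1_norm_diff l1_diff)
    with elim show ?case by simp
  qed
  fix x
  have "\<forall>\<^sub>F i in F. norm (f x - u i x) \<le> l1_norm G (\<lambda>x. f x - u i x)"
    using ul by eventually_elim (use group.l1_bounded[OF G] l1_diff f in blast)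
  then have "((\<lambda>i. norm (f x - u i x)) \<longlongrightarrow> 0) F"
    using lim by (intro tendsto_sandwich[OF _ _ tendsto_const lim]) auto
  then show "((\<lambda>i. u i x) \<longlongrightarrow> f x) F"
    by (simp add: tendsto_norm_zero_iff Lim_null[of "\<lambda>i. u i x"] norm_minus_commute[of "f x"])
qed

definition weak_star_closed_subspace :: "('a, 'b) monoid_scheme \<Rightarrow> ('a \<Rightarrow> complex) set \<Rightarrow> bool" where
  "weak_star_closed_subspace G D \<longleftrightarrow> closedin (weak_star G) D \<and> (\<lambda>_. 0) \<in> D \<and>
     (\<forall>f\<in>D. \<forall>g\<in>D. (\<lambda>x. f x + g x) \<in> D) \<and> (\<forall>c. \<forall>f\<in>D. (\<lambda>x. c * f x) \<in> D)"

lemma subspace_sum_closed: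
  assumes "(\<lambda>_. 0) \<in> D" and "\<And>f g. f \<in> D \<Longrightarrow> g \<in> D \<Longrightarrow> (\<lambda>x. f x + g x) \<in> D"
    and "\<And>i. i \<in> S \<Longrightarrow> v i \<in> D"
  shows "(\<lambda>x. \<Sum>i\<in>S. v i x) \<in> D"
  using assms(3)
proof (induction S rule: infinite_finite_induct)
  case (insert i S)
  then show ?case using assms(2)[of "v i" "\<lambda>x. \<Sum>i\<in>S. v i x"] by simp
qed (use assms(1) in simp_all)

text \<open>Infinite combinations with summable coefficients \<open>g\<close>: the finite partial sums lie in \<open>D\<close>, are
  bounded in norm by \<open>l1_norm G g * \<bar>M\<bar>\<close> and converge pointwise. For convolution products the \<open>v y\<close>
  are translates of one function.\<close>

lemma weak_star_closed_subspace_combination: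
  assumes D: "weak_star_closed_subspace G D" and g: "g \<in> l1 G"
    and v: "\<And>y. y \<in> carrier G \<Longrightarrow> v y \<in> D" "\<And>y. y \<in> carrier G \<Longrightarrow> l1_norm G (v y) \<le> M"
    and w: "w \<in> l1 G"
      "\<And>x. x \<in> carrier G \<Longrightarrow> ((\<lambda>y. g y * v y x) has_sum w x) (carrier G)"
  shows "w \<in> D"
proof (rule weak_star_closed_bounded_limit)
  let ?F = "finite_subsets_at_top (carrier G)"
  let ?u = "\<lambda>S x. \<Sum>y\<in>S. g y * v y x"
  show cl: "closedin (weak_star G) D"
    using D by (simp add: weak_star_closed_subspace_def)
  then have Dl: "D \<subseteq> l1 G"
    using closedin_subset by fastforce
  have ev: "\<forall>\<^sub>F S in ?F. finite S \<and> S \<subseteq> carrier G"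
    by (rule eventually_finite_subsets_at_top_weakI) simp
  show "\<forall>\<^sub>F S in ?F. ?u S \<in> D"
    using ev
  proof eventually_elim
    case (elim S)
    show ?case
      using D elim v(1) by (intro subspace_sum_closed) (auto simp: weak_star_closed_subspace_def)
  qed
  show "\<forall>\<^sub>F S in ?F. l1_norm G (?u S) \<le> l1_norm G g * \<bar>M\<bar>"
    using ev
  proof eventually_elim
    case (elim S)
    have "l1_norm G (?u S) \<le> (\<Sum>y\<in>S. l1_norm G (\<lambda>x. g y * v y x))"
      using elim v(1) Dl by (intro l1_norm_sum l1_scale) auto
    also have "\<dots> \<le> (\<Sum>y\<in>S. norm (g y) * \<bar>M\<bar>)"
      unfolding l1_norm_scale using elim v(2) by (intro sum_mono mult_left_mono) (auto intro: order_trans[OF _ abs_ge_self])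
    also have "\<dots> \<le> l1_norm G g * \<bar>M\<bar>"
      unfolding sum_distrib_right[symmetric] l1_norm_def using elim g
      by (intro mult_right_mono finite_sum_le_infsum) (auto simp: l1_def)
    finally show ?case .
  qed
  show "((\<lambda>S. ?u S x) \<longlongrightarrow> w x) ?F" if "x \<in> carrier G" for x
    using w(2)[OF that] by (simp add: has_sum_def)
qed (use w(1) in auto)

section \<open>Translations and ideals\<close>

lemma conv_outside [simp]: "x \<notin> carrier G \<Longrightarrow> conv G f g x = 0"
  by (simp add: conv_def)

context group
begin

lemma conv_delta_conj:
  assumes "s \<in> carrier G" "x \<in> carrier G"
  shows "conv G (conv G (delta s) f) (delta (inv s)) x = f (inv s \<otimes> x \<otimes> s)"
  using assms by (simp add: conv_delta_left conv_delta_right m_assoc)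

lemma bij_betw_right_translation:
  "y \<in> carrier G \<Longrightarrow> bij_betw (\<lambda>x. x \<otimes> inv y) (carrier G) (carrier G)"
  by (rule bij_betwI[where g = "\<lambda>x. x \<otimes> y"]) (auto simp: m_assoc)

lemma l1_norm_conv_delta_left:
  assumes "s \<in> carrier G"
  shows "l1_norm G (conv G (delta s) f) = l1_norm G f"
  unfolding l1_norm_def
  using assms infsum_reindex_bij_betw[OF bij_betw_left_translation[OF assms], of "\<lambda>x. norm (f x)"]
  by (simp add: conv_delta_left cong: infsum_cong)

lemma l1_norm_conv_delta_right:
  assumes "s \<in> carrier G"
  shows "l1_norm G (conv G f (delta s)) = l1_norm G f"
  unfolding l1_norm_def
  using assms infsum_reindex_bij_betw[OF bij_betw_right_translation[OF assms], of "\<lambda>x. norm (f x)"]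
  by (simp add: conv_delta_right cong: infsum_cong)

lemma conv_in_subspace_left:
  assumes D: "weak_star_closed_subspace G D" and f: "f \<in> l1 G" and g: "g \<in> l1 G"
    and "\<And>s. s \<in> carrier G \<Longrightarrow> conv G (delta s) f \<in> D"
  shows "conv G g f \<in> D"
proof (rule weak_star_closed_subspace_combination[OF D g, where v = "\<lambda>s. conv G (delta s) f"])
  fix x assume x: "x \<in> carrier G"
  have "((\<lambda>y. g y * f (inv y \<otimes> x)) has_sum conv G g f x) (carrier G)"
    using conv_summand_summable[OF g f x] x by (simp add: conv_def)
  then show "((\<lambda>y. g y * conv G (delta y) f x) has_sum conv G g f x) (carrier G)"
    using x by (simp add: conv_delta_left cong: has_sum_cong)
qed (use assms l1_norm_conv_delta_left conv_in_l1 in auto)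

lemma conv_in_subspace_right:
  assumes D: "weak_star_closed_subspace G D" and f: "f \<in> l1 G" and g: "g \<in> l1 G"
    and "\<And>s. s \<in> carrier G \<Longrightarrow> conv G f (delta s) \<in> D"
  shows "conv G f g \<in> D"
proof (rule weak_star_closed_subspace_combination[OF D g, where v = "\<lambda>s. conv G f (delta s)"])
  fix x assume x: "x \<in> carrier G"
  have "bij_betw (\<lambda>y. x \<otimes> inv y) (carrier G) (carrier G)"
    using x by (intro bij_betwI[where g = "\<lambda>z. inv z \<otimes> x"]) (auto simp: inv_mult_group m_assoc)
  then have "((\<lambda>y. f (x \<otimes> inv y) * g (inv (x \<otimes> inv y) \<otimes> x)) has_sum conv G f g x) (carrier G)"
    using conv_summand_summable[OF f g x] x
      has_sum_reindex_bij_betw[of "\<lambda>y. x \<otimes> inv y" _ _ "\<lambda>z. f z * g (inv z \<otimes> x)"]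
    by (simp add: conv_def)
  then show "((\<lambda>y. g y * conv G f (delta y) x) has_sum conv G f g x) (carrier G)"
    using x by (simp add: conv_delta_right inv_mult_group m_assoc mult.commute cong: has_sum_cong)
qed (use assms l1_norm_conv_delta_right conv_in_l1 in auto)

lemma l1_ideal_iff:
  "l1_ideal G J \<longleftrightarrow> J \<subseteq> l1 G \<and> (\<lambda>_. 0) \<in> J \<and>
     (\<forall>f\<in>J. \<forall>g\<in>J. (\<lambda>x. f x + g x) \<in> J) \<and> (\<forall>c. \<forall>f\<in>J. (\<lambda>x. c * f x) \<in> J) \<and>
     (\<forall>f\<in>J. \<forall>g\<in>l1 G. conv G g f \<in> J \<and> conv G f g \<in> J)"
  (is "_ \<longleftrightarrow> ?R")
proof
  interpret R: ring "l1_algebra G" by (rule ring_l1_algebra)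
  show ?R if J: "l1_ideal G J"
  proof -
    interpret J: ideal J "l1_algebra G"
      using J by (simp add: l1_ideal_def)
    show ?thesis
      using J J.a_subset J.zero_closed J.a_closed J.I_l_closed J.I_r_closed
      by (auto simp: l1_algebra_def l1_ideal_def)
  qed
  assume J: ?R
  have inv: "inv\<^bsub>add_monoid (l1_algebra G)\<^esub> f \<in> J" if f: "f \<in> J" for f
  proof -
    have m: "(\<lambda>x. - f x) \<in> J"
      using J f by (metis (no_types, lifting) ext mult_minus1)
    have "\<ominus>\<^bsub>l1_algebra G\<^esub> f = (\<lambda>x. - f x)"
      using J f m by (intro R.minus_equality) (auto simp: l1_algebra_def)
    with m show ?thesis
      by (simp add: a_inv_def)
  qed
  have "subgroup J (add_monoid (l1_algebra G))"
    using J inv by (intro subgroup.intro) (auto simp: l1_algebra_def)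
  then have "ideal J (l1_algebra G)"
    using J by (intro idealI[OF ring_l1_algebra]) (auto simp: l1_algebra_def)
  with J show "l1_ideal G J"
    by (auto simp: l1_ideal_def)
qed

lemma l1_ideal_closed_subspace:
  assumes "l1_ideal G I" "closedin (weak_star G) I"
  shows "weak_star_closed_subspace G I"
  using assms by (simp add: l1_ideal_iff weak_star_closed_subspace_def)

lemma l1_ideal_conj_closed:
  assumes "l1_ideal G I" "f \<in> I" "s \<in> carrier G"
  shows "conv G (conv G (delta s) f) (delta (inv s)) \<in> I"
proof -
  have "conv G (delta s) f \<in> I"
    using assms delta_in_l1[OF assms(3)] by (simp add: l1_ideal_iff)
  then show ?thesis
    using assms(1) delta_in_l1[OF inv_closed[OF assms(3)]] by (simp add: l1_ideal_iff)
qed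

section \<open>Restriction of an ideal to the FC-centre\<close>

lemma l1_finite_level_sets:
  assumes "f \<in> l1 G" "e > 0"
  shows "finite {x \<in> carrier G. norm (f x) \<ge> e}"
proof (rule conjunct1[OF finite_if_finite_subsets_card_bdd[of _ "nat \<lceil>l1_norm G f / e\<rceil>"]])
  fix A assume A: "A \<subseteq> {x \<in> carrier G. norm (f x) \<ge> e}" "finite A"
  have "card A * e \<le> (\<Sum>x\<in>A. norm (f x))"
    using A sum_mono[of A "\<lambda>_. e" "\<lambda>x. norm (f x)"] by auto
  also have "\<dots> \<le> l1_norm G f"
    unfolding l1_norm_def using assms A by (intro finite_sum_le_infsum) (auto simp: l1_def)
  finally have "real (card A) \<le> l1_norm G f / e"
    using assms(2) by (simp add: field_simps)
  then show "card A \<le> nat \<lceil>l1_norm G f / e\<rceil>"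
    by linarith
qed

lemma l1_restrict:
  assumes "f \<in> l1 G"
  shows "(\<lambda>x. if x \<in> N then f x else 0) \<in> l1 G"
proof -
  have "(\<lambda>x. norm (f x)) summable_on carrier G"
    using assms by (simp add: l1_def)
  then have "(\<lambda>x. norm (if x \<in> N then f x else 0)) summable_on carrier G"
    by (rule summable_on_comparison_test) simp_all
  with assms show ?thesis by (simp add: l1_def)
qed

text \<open>Conjugate \<open>f\<close> by elements that centralize more and more of the FC-centre and move more and more
  of its complement off itself. The conjugates do not change the values on the FC-centre and tend to
  \<open>0\<close> pointwise elsewhere, because \<open>f\<close> is small off a finite set; so they converge to the
  restriction of \<open>f\<close>.\<close>

lemma restrict_FC_in_ideal:
  assumes I: "l1_ideal G I" "closedin (weak_star G) I" and f: "f \<in> I"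
  shows "(\<lambda>x. if x \<in> FC G then f x else 0) \<in> I"
proof -
  have fl: "f \<in> l1 G"
    using I(1) f by (auto simp: l1_ideal_iff)
  let ?F = "finite_subsets_at_top (carrier G)"
  have "\<forall>K\<in>{K. finite K \<and> K \<subseteq> carrier G}. \<exists>s. s \<in> carrier G \<and>
      (\<forall>x\<in>K \<inter> FC G. inv s \<otimes> x \<otimes> s = x) \<and> (\<forall>x\<in>K - FC G. inv s \<otimes> x \<otimes> s \<notin> K - FC G)"
    by (intro ballI exists_centralizing_displacement[unfolded Bex_def]) auto
  from bchoice[OF this] obtain s where displace: "\<forall>K\<in>{K. finite K \<and> K \<subseteq> carrier G}. s K \<in> carrier G \<and>
      (\<forall>x\<in>K \<inter> FC G. inv (s K) \<otimes> x \<otimes> s K = x) \<and>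
      (\<forall>x\<in>K - FC G. inv (s K) \<otimes> x \<otimes> s K \<notin> K - FC G)" ..
  have s: "s K \<in> carrier G"
      "\<And>x. x \<in> K \<Longrightarrow> x \<in> FC G \<Longrightarrow> inv (s K) \<otimes> x \<otimes> s K = x"
      "\<And>x. x \<in> K \<Longrightarrow> x \<notin> FC G \<Longrightarrow> inv (s K) \<otimes> x \<otimes> s K \<notin> K - FC G"
    if "finite K \<and> K \<subseteq> carrier G" for K
    using bspec[OF displace, of K] that by simp_all
  let ?u = "\<lambda>K. conv G (conv G (delta (s K)) f) (delta (inv (s K)))"
  have ev: "\<forall>\<^sub>F K in ?F. (finite K \<and> K \<subseteq> carrier G) \<and> A \<subseteq> K" if "finite A" "A \<subseteq> carrier G" for A
    using that by (auto simp: eventually_finite_subsets_at_top)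
  show ?thesis
  proof (rule weak_star_closed_bounded_limit[OF I(2), of ?F ?u])
    have fin: "\<forall>\<^sub>F K in ?F. finite K \<and> K \<subseteq> carrier G"
      by (rule eventually_finite_subsets_at_top_weakI) simp
    show "\<forall>\<^sub>F K in ?F. ?u K \<in> I"
      using fin by (rule eventually_mono) (rule l1_ideal_conj_closed[OF I(1) f s(1)])
    show "\<forall>\<^sub>F K in ?F. l1_norm G (?u K) \<le> l1_norm G f"
      using fin
    proof (rule eventually_mono)
      fix K assume "finite K \<and> K \<subseteq> carrier G"
      from s(1)[OF this] show "l1_norm G (?u K) \<le> l1_norm G f"
        by (simp add: l1_norm_conv_delta_left l1_norm_conv_delta_right)
    qed
    show "(\<lambda>x. if x \<in> FC G then f x else 0) \<in> l1 G"
      using fl by (rule l1_restrict)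
    fix x assume x: "x \<in> carrier G"
    show "((\<lambda>K. ?u K x) \<longlongrightarrow> (if x \<in> FC G then f x else 0)) ?F"
    proof (cases "x \<in> FC G")
      case True
      have "\<forall>\<^sub>F K in ?F. ?u K x = f x"
      proof (rule eventually_mono[OF ev[of "{x}"]])
        fix K assume K: "(finite K \<and> K \<subseteq> carrier G) \<and> {x} \<subseteq> K"
        then show "?u K x = f x"
          using s(1)[of K] s(2)[of K x] x True by (simp add: conv_delta_conj)
      qed (use x in simp_all)
      with True show ?thesis
        by (simp add: tendsto_eventually)
    next
      case False
      interpret FC: normal "FC G" G by (rule normal_FC)
      have "((\<lambda>K. ?u K x) \<longlongrightarrow> 0) ?F"
      proof (rule tendstoI)
        fix e :: real assume e: "e > 0"
        \<comment> \<open>Once \<open>K\<close> contains \<open>A\<close>, the conjugate of \<open>x\<close> lies neither in \<open>K\<close> nor in the FC-centre,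
          hence outside the set where \<open>f\<close> is at least \<open>e\<close>.\<close>
        define A where "A = insert x {x \<in> carrier G. norm (f x) \<ge> e}"
        have "finite A" "A \<subseteq> carrier G"
          unfolding A_def using l1_finite_level_sets[OF fl e] x by blast+
        from ev[OF this] show "\<forall>\<^sub>F K in ?F. dist (?u K x) 0 < e"
        proof eventually_elim
          case (elim K)
          define y where "y = inv (s K) \<otimes> x \<otimes> s K"
          have sK: "s K \<in> carrier G"
            by (rule s(1)[OF conjunct1[OF elim]])
          then have y: "y \<in> carrier G" "x = s K \<otimes> y \<otimes> inv (s K)"
            using x conj_eq_iff[of "s K" x y] y_def m_closed inv_closed by metis+
          have "y \<notin> FC G"
          proof
            assume "y \<in> FC G"
            from FC.inv_op_closed2[OF sK this] y(2) False show False by simp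
          qed
          have "x \<in> K"
            using elim by (simp add: A_def)
          from s(3)[OF conjunct1[OF elim] this False] \<open>y \<notin> FC G\<close> have "y \<notin> K"
            by (simp add: y_def)
          then have "norm (f y) < e"
            using elim y(1) by (auto simp: A_def not_le[symmetric] simp del: not_le)
          then show ?case
            using sK x by (simp add: conv_delta_conj y_def)
        qed
      qed
      with False show ?thesis by simp
    qed
  qed simp
qed

end

section \<open>Functions on a subgroup and parts over cosets\<close>

text \<open>The restriction of \<open>conv G (delta (inv t)) f\<close> to \<open>N\<close>: the part of \<open>f\<close> over the coset
  \<open>t <# N\<close>, moved to \<open>N\<close>.\<close>

definition coset_part ::
    "('a, 'b) monoid_scheme \<Rightarrow> 'a set \<Rightarrow> 'a \<Rightarrow> ('a \<Rightarrow> complex) \<Rightarrow> 'a \<Rightarrow> complex" where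
  "coset_part G N t f = (\<lambda>x. if x \<in> N then f (t \<otimes>\<^bsub>G\<^esub> x) else 0)"

lemma l1_subgroup_iff:
  assumes "N \<subseteq> carrier G"
  shows "f \<in> l1 (G\<lparr>carrier := N\<rparr>) \<longleftrightarrow> f \<in> l1 G \<and> (\<forall>x. x \<notin> N \<longrightarrow> f x = 0)"
proof -
  have "(\<lambda>x. norm (f x)) summable_on N \<longleftrightarrow> (\<lambda>x. norm (f x)) summable_on carrier G"
    if "\<forall>x. x \<notin> N \<longrightarrow> f x = 0"
    using that assms by (intro summable_on_cong_neutral) auto
  with assms show ?thesis by (auto simp: l1_def)
qed

context group
begin

lemma conv_subgroup:
  assumes N: "subgroup N G" and f: "f \<in> l1 (G\<lparr>carrier := N\<rparr>)" and g: "g \<in> l1 (G\<lparr>carrier := N\<rparr>)"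
  shows "conv (G\<lparr>carrier := N\<rparr>) f g = conv G f g"
proof
  fix x
  have Nc: "N \<subseteq> carrier G"
    by (rule subgroup.subset[OF N])
  have f0: "f y = 0" if "y \<notin> N" for y
    using f that by (simp add: l1_def)
  have g0: "g y = 0" if "y \<notin> N" for y
    using g that by (simp add: l1_def)
  show "conv (G\<lparr>carrier := N\<rparr>) f g x = conv G f g x"
  proof (cases "x \<in> N")
    case True
    have "(\<Sum>\<^sub>\<infinity>y\<in>N. f y * g (inv\<^bsub>G\<lparr>carrier := N\<rparr>\<^esub> y \<otimes> x)) = (\<Sum>\<^sub>\<infinity>y\<in>N. f y * g (inv y \<otimes> x))"
      by (rule infsum_cong) (simp add: m_inv_consistent[OF N])
    also have "\<dots> = (\<Sum>\<^sub>\<infinity>y\<in>carrier G. f y * g (inv y \<otimes> x))"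
      using Nc f0 by (intro infsum_cong_neutral) auto
    finally show ?thesis
      using True Nc by (simp add: conv_def subsetD)
  next
    case False
    have "f y * g (inv y \<otimes> x) = 0" if x: "x \<in> carrier G" and y: "y \<in> carrier G" for y
    proof (cases "y \<in> N")
      case yN: True
      have "inv y \<otimes> x \<notin> N"
      proof
        assume "inv y \<otimes> x \<in> N"
        from subgroup.m_closed[OF N yN this] show False
          using x y False by simp
      qed
      then show ?thesis by (simp add: g0)
    qed (simp add: f0)
    then have "(\<Sum>\<^sub>\<infinity>y\<in>carrier G. f y * g (inv y \<otimes> x)) = 0" if "x \<in> carrier G"
      using that by (intro infsum_0)
    with False show ?thesis
      by (simp add: conv_def)
  qed
qed

lemma coset_part_in_l1:
  assumes N: "subgroup N G" and t: "t \<in> carrier G" and f: "f \<in> l1 G"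
  shows "coset_part G N t f \<in> l1 (G\<lparr>carrier := N\<rparr>)"
proof -
  have Nc: "N \<subseteq> carrier G"
    by (rule subgroup.subset[OF N])
  have "coset_part G N t f = (\<lambda>x. if x \<in> N then conv G (delta (inv t)) f x else 0)"
    using t Nc by (auto simp: coset_part_def conv_delta_left subsetD)
  moreover have "\<dots> \<in> l1 G"
    using t f by (intro l1_restrict conv_in_l1 delta_in_l1) simp_all
  ultimately show ?thesis
    unfolding l1_subgroup_iff[OF Nc] by (simp add: coset_part_def)
qed

text \<open>The predual map extends \<open>h \<in> c0 N\<close> by zero after moving it to the coset.\<close>

lemma continuous_map_coset_part:
  assumes N: "subgroup N G" and t: "t \<in> carrier G"
  shows "continuous_map (weak_star G) (weak_star (G\<lparr>carrier := N\<rparr>)) (coset_part G N t)"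
proof (rule continuous_map_weak_star)
  have Nc: "N \<subseteq> carrier G"
    by (rule subgroup.subset[OF N])
  fix h assume h: "h \<in> c0 (G\<lparr>carrier := N\<rparr>)"
  have h0: "h x = 0" if "x \<notin> N" for x
    using h that by (simp add: c0_def)
  define k where "k y = (if y \<in> carrier G then h (inv t \<otimes> y) else 0)" for y
  have "finite {y \<in> carrier G. norm (k y) \<ge> e}" if e: "e > 0" for e
  proof (rule finite_subset)
    show "{y \<in> carrier G. norm (k y) \<ge> e} \<subseteq> (\<lambda>x. t \<otimes> x) ` {x \<in> N. norm (h x) \<ge> e}"
    proof
      fix y assume y: "y \<in> {y \<in> carrier G. norm (k y) \<ge> e}"
      then have "y \<in> carrier G" "norm (k y) \<ge> e"
        by simp_all
      then have "norm (h (inv t \<otimes> y)) \<ge> e" "y = t \<otimes> (inv t \<otimes> y)"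
        using t by (simp_all add: k_def)
      moreover from this(1) e have "inv t \<otimes> y \<in> N"
        using h0[of "inv t \<otimes> y"] by (cases "inv t \<otimes> y \<in> N") simp_all
      ultimately show "y \<in> (\<lambda>x. t \<otimes> x) ` {x \<in> N. norm (h x) \<ge> e}"
        by (intro image_eqI[of _ _ "inv t \<otimes> y"]) simp_all
    qed
    show "finite ((\<lambda>x. t \<otimes> x) ` {x \<in> N. norm (h x) \<ge> e})"
      using h e by (simp add: c0_def)
  qed
  then have "k \<in> c0 G"
    by (simp add: c0_def k_def)
  moreover have "(\<Sum>\<^sub>\<infinity>x\<in>carrier (G\<lparr>carrier := N\<rparr>). coset_part G N t f x * h x) = (\<Sum>\<^sub>\<infinity>y\<in>carrier G. f y * k y)"
    for f
  proof -
    have "(\<Sum>\<^sub>\<infinity>x\<in>carrier (G\<lparr>carrier := N\<rparr>). coset_part G N t f x * h x) =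
        (\<Sum>\<^sub>\<infinity>x\<in>carrier G. f (t \<otimes> x) * h x)"
      using Nc by (intro infsum_cong_neutral) (auto simp: coset_part_def h0)
    also have "\<dots> = (\<Sum>\<^sub>\<infinity>y\<in>carrier G. f (t \<otimes> (inv t \<otimes> y)) * h (inv t \<otimes> y))"
      by (rule infsum_reindex_bij_betw[OF bij_betw_left_translation[OF t], symmetric])
    also have "\<dots> = (\<Sum>\<^sub>\<infinity>y\<in>carrier G. f y * k y)"
      using t by (intro infsum_cong) (simp add: k_def)
    finally show ?thesis .
  qed
  ultimately show "\<exists>k\<in>c0 G. \<forall>f\<in>l1 G.
      (\<Sum>\<^sub>\<infinity>x\<in>carrier (G\<lparr>carrier := N\<rparr>). coset_part G N t f x * h x) = (\<Sum>\<^sub>\<infinity>x\<in>carrier G. f x * k x)"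
    by blast
qed (rule coset_part_in_l1[OF N t])

text \<open>The predual map of the inclusion is restriction to \<open>N\<close>.\<close>

lemma continuous_map_l1_inclusion:
  assumes Nc: "N \<subseteq> carrier G"
  shows "continuous_map (weak_star (G\<lparr>carrier := N\<rparr>)) (weak_star G) (\<lambda>f. f)"
proof (rule continuous_map_weak_star)
  fix h assume h: "h \<in> c0 G"
  define k where "k y = (if y \<in> N then h y else 0)" for y
  have "finite {y \<in> N. norm (k y) \<ge> e}" if e: "e > 0" for e
  proof (rule finite_subset)
    show "{y \<in> N. norm (k y) \<ge> e} \<subseteq> {x \<in> carrier G. norm (h x) \<ge> e}"
      using Nc by (auto simp: k_def)
    show "finite {x \<in> carrier G. norm (h x) \<ge> e}"
      using h e by (simp add: c0_def)
  qed
  then have "k \<in> c0 (G\<lparr>carrier := N\<rparr>)"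
    by (simp add: c0_def k_def)
  moreover have "(\<Sum>\<^sub>\<infinity>x\<in>carrier G. f x * h x) = (\<Sum>\<^sub>\<infinity>y\<in>carrier (G\<lparr>carrier := N\<rparr>). f y * k y)"
    if "f \<in> l1 (G\<lparr>carrier := N\<rparr>)" for f
    using Nc that by (intro infsum_cong_neutral) (auto simp: k_def l1_def)
  ultimately show "\<exists>k\<in>c0 (G\<lparr>carrier := N\<rparr>). \<forall>f\<in>l1 (G\<lparr>carrier := N\<rparr>).
      (\<Sum>\<^sub>\<infinity>x\<in>carrier G. f x * h x) = (\<Sum>\<^sub>\<infinity>x\<in>carrier (G\<lparr>carrier := N\<rparr>). f x * k x)"
    by blast
qed (simp add: l1_subgroup_iff[OF Nc])

lemma transversal_representative:
  assumes N: "subgroup N G" and T: "transversal G N T" and x: "x \<in> carrier G"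
  shows "\<exists>r\<in>T. \<forall>t\<in>T. inv t \<otimes> x \<in> N \<longleftrightarrow> t = r"
proof -
  have Tc: "T \<subseteq> carrier G"
    using T by (simp add: transversal_def)
  have mem: "t \<in> x <#\<^bsub>G\<^esub> N \<longleftrightarrow> inv t \<otimes> x \<in> N" if t: "t \<in> T" for t
  proof -
    have tc: "t \<in> carrier G"
      using t Tc by (rule subsetD[rotated])
    have "t \<in> x <#\<^bsub>G\<^esub> N \<longleftrightarrow> inv x \<otimes> t \<in> N"
      using subgroup.lcos_module_imp[OF N is_group x] subgroup.lcos_module_rev[OF N is_group x tc] by blast
    also have "\<dots> \<longleftrightarrow> inv (inv x \<otimes> t) \<in> N"
      using subgroup.m_inv_closed[OF N] x tc by (metis inv_closed inv_inv m_closed)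
    also have "inv (inv x \<otimes> t) = inv t \<otimes> x"
      using x tc by (simp add: inv_mult_group)
    finally show ?thesis .
  qed
  have "x <#\<^bsub>G\<^esub> N \<in> lcosets N"
    using x by (auto simp: LCOSETS_def)
  then have ex1: "\<exists>!t. t \<in> T \<inter> (x <#\<^bsub>G\<^esub> N)"
    using T unfolding transversal_def by (elim conjE) (rule bspec)
  define r where "r = (THE t. t \<in> T \<inter> (x <#\<^bsub>G\<^esub> N))"
  have r: "r \<in> T \<inter> (x <#\<^bsub>G\<^esub> N)"
    unfolding r_def by (rule theI'[OF ex1])
  have uniq: "t = r" if "t \<in> T \<inter> (x <#\<^bsub>G\<^esub> N)" for t
    unfolding r_def by (rule the1_equality[OF ex1 that, symmetric])
  show ?thesis
  proof (intro bexI ballI)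
    show "inv t \<otimes> x \<in> N \<longleftrightarrow> t = r" if "t \<in> T" for t
      using r uniq[of t] mem[OF that] that by auto
    show "r \<in> T"
      using r by simp
  qed
qed

text \<open>Over \<open>x\<close> only the summand of the representative of \<open>x\<close> can be nonzero. So the summands of a
  convergent sum are the coset parts of its limit; conversely the partial sums of the coset parts of
  \<open>f\<close> agree with \<open>f\<close> on finitely many cosets and vanish on the others.\<close>

lemma l1_direct_sum_eq:
  assumes N: "subgroup N G" and T: "transversal G N T" and J: "J \<subseteq> l1 (G\<lparr>carrier := N\<rparr>)"
  shows "l1_direct_sum G T J = {f \<in> l1 G. \<forall>t\<in>T. coset_part G N t f \<in> J}"
proof -
  have Nc: "N \<subseteq> carrier G"
    by (rule subgroup.subset[OF N])
  have Tc: "T \<subseteq> carrier G"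
    using T by (simp add: transversal_def)
  have "\<forall>x\<in>carrier G. \<exists>r. r \<in> T \<and> (\<forall>t\<in>T. inv t \<otimes> x \<in> N \<longleftrightarrow> t = r)"
    using transversal_representative[OF N T] by (simp add: Bex_def)
  from bchoice[OF this] obtain rep where
    rep: "\<forall>x\<in>carrier G. rep x \<in> T \<and> (\<forall>t\<in>T. inv t \<otimes> x \<in> N \<longleftrightarrow> t = rep x)" ..
  \<comment> \<open>A summand vanishes off its own coset, and \<open>rep\<close> picks the only coset that contains \<open>x\<close>.\<close>
  have sum_at: "(\<Sum>t\<in>S. conv G (delta t) (F t) x) =
      (if rep x \<in> S then F (rep x) (inv (rep x) \<otimes> x) else 0)"
    if S: "finite S" "S \<subseteq> T" and F: "\<And>t. t \<in> S \<Longrightarrow> F t \<in> l1 (G\<lparr>carrier := N\<rparr>)" and x: "x \<in> carrier G"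
    for S x and F :: "'a \<Rightarrow> 'a \<Rightarrow> complex"
  proof -
    have "conv G (delta t) (F t) x = (if t = rep x then F (rep x) (inv (rep x) \<otimes> x) else 0)"
      if t: "t \<in> S" for t
    proof -
      have "inv t \<otimes> x \<in> N \<longleftrightarrow> t = rep x" "t \<in> carrier G"
        using rep x S Tc t by (simp_all add: subset_iff)
      with F[OF t] x show ?thesis
        by (auto simp: conv_delta_left l1_def)
    qed
    then have "(\<Sum>t\<in>S. conv G (delta t) (F t) x) =
        (\<Sum>t\<in>S. if t = rep x then F (rep x) (inv (rep x) \<otimes> x) else 0)"
      by (rule sum.cong[OF refl])
    with S(1) show ?thesis by simp
  qed
  show ?thesis
  proof (intro equalityI subsetI)
    fix f assume "f \<in> l1_direct_sum G T J"
    then obtain F where f: "f \<in> l1 G" and F: "\<And>t. t \<in> T \<Longrightarrow> F t \<in> J"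
      and lim: "((\<lambda>S. l1_norm G (\<lambda>x. f x - (\<Sum>t\<in>S. conv G (delta t) (F t) x))) \<longlongrightarrow> 0)
        (finite_subsets_at_top T)"
      unfolding l1_direct_sum_def by auto
    have Fl: "F t \<in> l1 (G\<lparr>carrier := N\<rparr>)" "F t \<in> l1 G" if "t \<in> T" for t
      using F[OF that] J l1_subgroup_iff[OF Nc] by (simp_all add: subset_iff)
    have "coset_part G N t f = F t" if t: "t \<in> T" for t
    proof
      fix x
      show "coset_part G N t f x = F t x"
      proof (cases "x \<in> N")
        case False
        with Fl(1)[OF t] show ?thesis
          by (simp add: coset_part_def l1_def)
      next
        case True
        have tc: "t \<in> carrier G" and xc: "x \<in> carrier G"
          using t Tc True Nc by (simp_all add: subset_iff)
        have r: "rep (t \<otimes> x) = t"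
          using bspec[OF rep m_closed[OF tc xc]] t True tc xc by (metis cancel_inv(1))
        have "norm (f (t \<otimes> x) - F t x) \<le> 0"
        proof (rule tendsto_lowerbound[OF lim])
          show "\<forall>\<^sub>F S in finite_subsets_at_top T. norm (f (t \<otimes> x) - F t x)
              \<le> l1_norm G (\<lambda>x. f x - (\<Sum>t\<in>S. conv G (delta t) (F t) x))"
            unfolding eventually_finite_subsets_at_top
          proof (intro exI[of _ "{t}"] conjI allI impI)
            fix S assume S: "finite S \<and> {t} \<subseteq> S \<and> S \<subseteq> T"
            have ST: "s \<in> T" if "s \<in> S" for s
              using S that by blast
            have "conv G (delta s) (F s) \<in> l1 G" if "s \<in> S" for s
              using ST[OF that] Tc Fl(2) by (intro conv_in_l1 delta_in_l1) (simp_all add: subset_iff)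
            then have "(\<lambda>x. f x - (\<Sum>t\<in>S. conv G (delta t) (F t) x)) \<in> l1 G"
              using f by (intro l1_diff l1_sum)
            from l1_bounded[OF this, of "t \<otimes> x"]
            show "norm (f (t \<otimes> x) - F t x)
                \<le> l1_norm G (\<lambda>x. f x - (\<Sum>t\<in>S. conv G (delta t) (F t) x))"
              using sum_at[of S F "t \<otimes> x"] S ST Fl(1) tc xc by (simp add: r)
          qed (use t in simp_all)
        qed simp
        with True show ?thesis by (simp add: coset_part_def)
      qed
    qed
    with f F show "f \<in> {f \<in> l1 G. \<forall>t\<in>T. coset_part G N t f \<in> J}"
      by simp
  next
    fix f assume "f \<in> {f \<in> l1 G. \<forall>t\<in>T. coset_part G N t f \<in> J}"
    then have f: "f \<in> l1 G" and fJ: "\<And>t. t \<in> T \<Longrightarrow> coset_part G N t f \<in> J"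
      by simp_all
    have fs: "(\<lambda>x. norm (f x)) summable_on carrier G"
      using f by (simp add: l1_def)
    let ?d = "\<lambda>S x. f x - (\<Sum>t\<in>S. conv G (delta t) (coset_part G N t f) x)"
    have d: "?d S x = (if rep x \<in> S then 0 else f x)"
      if S: "finite S" "S \<subseteq> T" and x: "x \<in> carrier G" for S x
    proof -
      have "rep x \<in> T" "inv (rep x) \<otimes> x \<in> N"
        using bspec[OF rep x] by simp_all
      moreover from this have "rep x \<in> carrier G"
        using Tc by (simp add: subset_iff)
      ultimately show ?thesis
        using sum_at[OF S _ x, of "\<lambda>t. coset_part G N t f"] coset_part_in_l1[OF N _ f] S Tc x
        by (simp add: coset_part_def subset_iff)
    qed
    have "((\<lambda>S. l1_norm G (?d S)) \<longlongrightarrow> 0) (finite_subsets_at_top T)"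
    proof (rule tendstoI)
      fix e :: real assume e: "e > 0"
      have "((\<lambda>x. norm (f x)) has_sum l1_norm G f) (carrier G)"
        using fs by (simp add: l1_norm_def)
      moreover have "l1_norm G f - e < l1_norm G f"
        using e by linarith
      ultimately have "\<forall>\<^sub>F A in finite_subsets_at_top (carrier G). l1_norm G f - e < (\<Sum>x\<in>A. norm (f x))"
        unfolding has_sum_def by (rule order_tendstoD(1))
      then obtain A where A: "finite A" "A \<subseteq> carrier G" "l1_norm G f - e < (\<Sum>x\<in>A. norm (f x))"
        unfolding eventually_finite_subsets_at_top by blast
      show "\<forall>\<^sub>F S in finite_subsets_at_top T. dist (l1_norm G (?d S)) 0 < e"
        unfolding eventually_finite_subsets_at_top
      proof (intro exI[of _ "rep ` A"] conjI allI impI)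
        show "rep ` A \<subseteq> T"
          using subsetD[OF A(2)] rep by (simp add: image_subset_iff)
        fix S assume S: "finite S \<and> rep ` A \<subseteq> S \<and> S \<subseteq> T"
        have "l1_norm G (?d S) = (\<Sum>\<^sub>\<infinity>x\<in>carrier G. norm (if rep x \<in> S then 0 else f x))"
          unfolding l1_norm_def using S by (intro infsum_cong) (simp add: d)
        also have "\<dots> = (\<Sum>\<^sub>\<infinity>x\<in>carrier G - A. norm (if rep x \<in> S then 0 else f x))"
          using S by (intro infsum_cong_neutral) (auto simp: image_subset_iff)
        also have "\<dots> \<le> (\<Sum>\<^sub>\<infinity>x\<in>carrier G - A. norm (f x))"
        proof (rule infsum_mono)
          show fA: "(\<lambda>x. norm (f x)) summable_on carrier G - A"
            by (rule summable_on_subset_banach[OF fs]) simp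
          show "(\<lambda>x. norm (if rep x \<in> S then 0 else f x)) summable_on carrier G - A"
            by (rule summable_on_comparison_test[OF fA]) simp_all
        qed simp
        also have "\<dots> = l1_norm G f - (\<Sum>x\<in>A. norm (f x))"
          using infsum_Diff[OF fs _ A(2)] A(1) by (simp add: l1_norm_def)
        also have "\<dots> < e"
          using A(3) by simp
        finally show "dist (l1_norm G (?d S)) 0 < e"
          by (simp add: l1_norm_nonneg)
      qed (use A in simp)
    qed
    with f fJ show "f \<in> l1_direct_sum G T J"
      unfolding l1_direct_sum_def by (intro CollectI conjI exI[of _ "\<lambda>t. coset_part G N t f"]) simp_all
  qed
qed

end

section \<open>The correspondence of ideals\<close>

context group
begin

text \<open>The inclusion for \<open>inv s\<close> gives the surjectivity for \<open>s\<close>.\<close>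

lemma conj_invariantI:
  assumes J: "J \<subseteq> l1 G"
    and closed: "\<And>s f. s \<in> carrier G \<Longrightarrow> f \<in> J \<Longrightarrow> conv G (conv G (delta s) f) (delta (inv s)) \<in> J"
  shows "conj_invariant G J"
  unfolding conj_invariant_def
proof (intro ballI equalityI subsetI)
  fix s f assume s: "s \<in> carrier G" and f: "f \<in> J"
  let ?g = "conv G (conv G (delta (inv s)) f) (delta (inv (inv s)))"
  have "f = conv G (conv G (delta s) ?g) (delta (inv s))"
  proof
    fix x
    show "f x = conv G (conv G (delta s) ?g) (delta (inv s)) x"
    proof (cases "x \<in> carrier G")
      case True
      then have "conv G (conv G (delta s) ?g) (delta (inv s)) x = ?g (inv s \<otimes> x \<otimes> s)"
        using s by (simp only: conv_delta_conj)
      also have "\<dots> = f (inv (inv s) \<otimes> (inv s \<otimes> x \<otimes> s) \<otimes> inv s)"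
        using s True by (intro conv_delta_conj) simp_all
      also have "\<dots> = f x"
        using s True by (simp add: m_assoc)
      finally show ?thesis by simp
    next
      case False
      with subsetD[OF J f] show ?thesis by (simp add: l1_def)
    qed
  qed
  moreover have "?g \<in> J"
    using s f by (intro closed) simp_all
  ultimately show "f \<in> (\<lambda>f. conv G (conv G (delta s) f) (delta (inv s))) ` J"
    by (rule image_eqI)
qed (use closed in force)

lemma conj_invariantD:
  assumes "conj_invariant G J" "f \<in> J" "s \<in> carrier G"
  shows "conv G (conv G (delta s) f) (delta (inv s)) \<in> J"
  using bspec[OF assms(1)[unfolded conj_invariant_def] assms(3)] imageI[OF assms(2)] by (rule subst)

text \<open>For \<open>f\<close> in \<open>I\<close>, the part over \<open>t <# FC G\<close> is the restriction to \<open>FC G\<close> of a left translate of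
  \<open>f\<close>, which is again in \<open>I\<close>. The other inclusion holds because \<open>I\<close> is closed under norm limits.\<close>

lemma closed_ideal_is_direct_sum:
  assumes I: "l1_ideal G I" "closedin (weak_star G) I" and T: "transversal G (FC G) T"
  defines "H \<equiv> G\<lparr>carrier := FC G\<rparr>"
  shows "l1_ideal H (I \<inter> l1 H)" and "closedin (weak_star H) (I \<inter> l1 H)"
    and "conj_invariant G (I \<inter> l1 H)" and "l1_direct_sum G T (I \<inter> l1 H) = I"
proof -
  interpret FC: normal "FC G" G by (rule normal_FC)
  have N: "subgroup (FC G) G" by (rule FC.subgroup_axioms)
  interpret H: group H
    unfolding H_def by (rule subgroup_imp_group[OF N])
  have lH: "f \<in> l1 H \<longleftrightarrow> f \<in> l1 G \<and> (\<forall>x. x \<notin> FC G \<longrightarrow> f x = 0)" for f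
    unfolding H_def by (rule l1_subgroup_iff[OF FC.subset])
  have Iid: "I \<subseteq> l1 G" "\<And>f g. f \<in> I \<Longrightarrow> g \<in> l1 G \<Longrightarrow> conv G g f \<in> I"
      "\<And>f g. f \<in> I \<Longrightarrow> g \<in> l1 G \<Longrightarrow> conv G f g \<in> I"
    using I(1) by (simp_all add: l1_ideal_iff)
  have sub: "weak_star_closed_subspace G I"
    by (rule l1_ideal_closed_subspace[OF I])
  have conv_H: "conv H f g = conv G f g" if "f \<in> l1 H" "g \<in> l1 H" for f g
    using that unfolding H_def by (rule conv_subgroup[OF N])
  show "l1_ideal H (I \<inter> l1 H)"
    unfolding H.l1_ideal_iff
  proof (intro conjI ballI allI)
    fix f g assume f: "f \<in> I \<inter> l1 H" and g: "g \<in> l1 H"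
    then have "g \<in> l1 G" by (simp add: lH)
    with f g show "conv H g f \<in> I \<inter> l1 H" "conv H f g \<in> I \<inter> l1 H"
      using H.conv_in_l1[of f g] H.conv_in_l1[of g f] Iid(2,3) conv_H[of f g] conv_H[of g f] by simp_all
  qed (use sub in \<open>simp_all add: weak_star_closed_subspace_def zero_in_l1 l1_add l1_scale\<close>)
  have "closedin (weak_star H) {f \<in> topspace (weak_star H). f \<in> I}"
    unfolding H_def
    by (rule closedin_continuous_map_preimage[OF continuous_map_l1_inclusion[OF FC.subset] I(2)])
  then show "closedin (weak_star H) (I \<inter> l1 H)"
    by (simp add: Int_def conj_commute)
  show "conj_invariant G (I \<inter> l1 H)"
  proof (rule conj_invariantI)
    fix s f assume s: "s \<in> carrier G" and f: "f \<in> I \<inter> l1 H"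
    let ?g = "conv G (conv G (delta s) f) (delta (inv s))"
    have g: "?g \<in> I"
      using f s by (intro l1_ideal_conj_closed[OF I(1)]) simp_all
    have "?g x = 0" if x: "x \<notin> FC G" for x
    proof (cases "x \<in> carrier G")
      case True
      have "inv s \<otimes> x \<otimes> s \<notin> FC G"
      proof
        assume "inv s \<otimes> x \<otimes> s \<in> FC G"
        from FC.inv_op_closed2[OF s this] s True x show False
          by (simp add: m_assoc)
      qed
      with s f True show ?thesis
        by (simp add: conv_delta_conj lH)
    qed simp
    with g Iid(1) show "?g \<in> I \<inter> l1 H"
      by (simp add: lH subset_iff)
  qed (use Iid(1) in blast)
  show "l1_direct_sum G T (I \<inter> l1 H) = I"
  proof (intro equalityI subsetI)
    fix f assume "f \<in> l1_direct_sum G T (I \<inter> l1 H)"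
    then obtain F where f: "f \<in> l1 G" and F: "\<forall>t\<in>T. F t \<in> I \<inter> l1 H"
      and lim: "((\<lambda>S. l1_norm G (\<lambda>x. f x - (\<Sum>t\<in>S. conv G (delta t) (F t) x))) \<longlongrightarrow> 0)
        (finite_subsets_at_top T)"
      unfolding l1_direct_sum_def by auto
    show "f \<in> I"
    proof (rule weak_star_closed_norm_limit[OF is_group I(2) _ _ f lim])
      have "\<forall>\<^sub>F S in finite_subsets_at_top T. S \<subseteq> T"
        by (rule eventually_finite_subsets_at_top_weakI) simp
      then show "\<forall>\<^sub>F S in finite_subsets_at_top T. (\<lambda>x. \<Sum>t\<in>S. conv G (delta t) (F t) x) \<in> I"
      proof (rule eventually_mono)
        fix S assume S: "S \<subseteq> T"
        show "(\<lambda>x. \<Sum>t\<in>S. conv G (delta t) (F t) x) \<in> I"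
        proof (rule subspace_sum_closed)
          fix t assume "t \<in> S"
          then have "t \<in> carrier G" "F t \<in> I"
            using S T F by (auto simp: transversal_def)
          then show "conv G (delta t) (F t) \<in> I"
            by (intro Iid(2) delta_in_l1)
        qed (use sub in \<open>simp_all add: weak_star_closed_subspace_def\<close>)
      qed
    qed simp
  next
    fix f assume f: "f \<in> I"
    have "coset_part G (FC G) t f \<in> I \<inter> l1 H" if "t \<in> T" for t
    proof -
      have t: "t \<in> carrier G"
        using that T by (auto simp: transversal_def)
      have "conv G (delta (inv t)) f \<in> I"
        using t f by (intro Iid(2) delta_in_l1) simp_all
      then have "(\<lambda>x. if x \<in> FC G then conv G (delta (inv t)) f x else 0) \<in> I"
        by (rule restrict_FC_in_ideal[OF I])
      moreover have "(\<lambda>x. if x \<in> FC G then conv G (delta (inv t)) f x else 0) = coset_part G (FC G) t f"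
        using t by (auto simp: coset_part_def conv_delta_left)
      moreover have "coset_part G (FC G) t f \<in> l1 H"
        unfolding H_def using coset_part_in_l1[OF N t] subsetD[OF Iid(1) f] by simp
      ultimately show ?thesis by simp
    qed
    then show "f \<in> l1_direct_sum G T (I \<inter> l1 H)"
      using subsetD[OF Iid(1) f] l1_direct_sum_eq[OF N T, of "I \<inter> l1 H"] by (simp add: H_def)
  qed
qed

text \<open>Changing the representative of a coset translates the coset part inside \<open>N\<close>, so if the parts at
  \<open>T\<close> lie in \<open>J\<close>, then so do the parts at all of \<open>G\<close>. Left translation permutes these parts, and
  right translation permutes them up to conjugation.\<close>

lemma direct_sum_is_closed_ideal:
  assumes nrm: "N \<lhd> G" and T: "transversal G N T"
  defines "H \<equiv> G\<lparr>carrier := N\<rparr>"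
  assumes J: "l1_ideal H J" "closedin (weak_star H) J" "conj_invariant G J"
  shows "l1_ideal G (l1_direct_sum G T J)" and "closedin (weak_star G) (l1_direct_sum G T J)"
proof -
  interpret N: normal N G by (rule nrm)
  have N: "subgroup N G" by (rule N.subgroup_axioms)
  interpret H: group H
    unfolding H_def by (rule subgroup_imp_group[OF N])
  have Jl: "J \<subseteq> l1 H"
    using J(1) by (simp add: H.l1_ideal_iff)
  have J0: "g x = 0" if "g \<in> J" "x \<notin> N" for g x
    using subsetD[OF Jl that(1)] that(2) by (simp add: H_def l1_def)
  define D where "D = {f \<in> l1 G. \<forall>s\<in>carrier G. coset_part G N s f \<in> J}"
  have D1: "f \<in> l1 G" if "f \<in> D" for f
    using that by (simp add: D_def)
  have D2: "coset_part G N s f \<in> J" if "f \<in> D" "s \<in> carrier G" for f s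
    using that by (simp add: D_def)
  have Tc: "T \<subseteq> carrier G"
    using T by (simp add: transversal_def)
  have all_parts: "coset_part G N s f \<in> J"
    if f: "\<forall>t\<in>T. coset_part G N t f \<in> J" and s: "s \<in> carrier G" for f s
  proof -
    obtain r where r: "r \<in> T" "\<forall>t\<in>T. inv t \<otimes> s \<in> N \<longleftrightarrow> t = r"
      using transversal_representative[OF N T s] by (elim bexE)
    define n where "n = inv r \<otimes> s"
    have n: "n \<in> N" "n \<in> carrier G" and rc: "r \<in> carrier G"
      using r Tc N.subset by (auto simp: n_def)
    have srn: "s = r \<otimes> n"
      using rc s by (simp add: n_def)
    have dn: "delta (inv n) \<in> l1 H"
      using delta_in_l1[of "inv n" H] n(1) by (simp add: H_def)
    have g: "coset_part G N r f \<in> J"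
      using f r(1) by simp
    have "conv H (delta (inv n)) (coset_part G N r f) \<in> J"
      using J(1) g dn by (simp add: H.l1_ideal_iff)
    moreover have "conv H (delta (inv n)) (coset_part G N r f) = conv G (delta (inv n)) (coset_part G N r f)"
      using dn subsetD[OF Jl g] unfolding H_def by (rule conv_subgroup[OF N])
    ultimately have cJ: "conv G (delta (inv n)) (coset_part G N r f) \<in> J"
      by simp
    have "coset_part G N s f = conv G (delta (inv n)) (coset_part G N r f)"
    proof
      fix x
      show "coset_part G N s f x = conv G (delta (inv n)) (coset_part G N r f) x"
      proof (cases "x \<in> N")
        case True
        then have "x \<in> carrier G" "n \<otimes> x \<in> N"
          using n(1) by simp_all
        then show ?thesis
          using True n rc by (simp add: coset_part_def conv_delta_left srn m_assoc)
      next
        case False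
        then show ?thesis
          using J0[OF cJ False] by (simp add: coset_part_def)
      qed
    qed
    with cJ show ?thesis by simp
  qed
  have D_eq: "D = {f \<in> l1 G. \<forall>t\<in>T. coset_part G N t f \<in> J}"
    unfolding D_def using Tc all_parts by blast
  also have "\<dots> = l1_direct_sum G T J"
    using l1_direct_sum_eq[OF N T Jl[unfolded H_def]] by simp
  finally have sum_eq: "l1_direct_sum G T J = D" ..
  have "D = \<Inter> (insert (l1 G) ((\<lambda>t. {f \<in> topspace (weak_star G). coset_part G N t f \<in> J}) ` T))"
    unfolding D_eq by auto
  also have "closedin (weak_star G) \<dots>"
  proof (rule closedin_Inter)
    fix S assume "S \<in> insert (l1 G) ((\<lambda>t. {f \<in> topspace (weak_star G). coset_part G N t f \<in> J}) ` T)"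
    then consider "S = l1 G"
      | t where "t \<in> T" "S = {f \<in> topspace (weak_star G). coset_part G N t f \<in> J}"
      by blast
    then show "closedin (weak_star G) S"
    proof cases
      case 1
      then show ?thesis
        using closedin_topspace[of "weak_star G"] by simp
    next
      case (2 t)
      then have "t \<in> carrier G"
        using Tc by blast
      from closedin_continuous_map_preimage[OF continuous_map_coset_part[OF N this] J(2)[unfolded H_def]] 2(2)
      show ?thesis by simp
    qed
  qed simp
  finally have closed: "closedin (weak_star G) D" .
  with sum_eq show "closedin (weak_star G) (l1_direct_sum G T J)"
    by simp
  have zero: "(\<lambda>_. 0) \<in> D"
  proof -
    have "coset_part G N s (\<lambda>_. 0) = (\<lambda>_. 0)" for s
      by (simp add: coset_part_def)
    then show ?thesis
      using J(1) by (simp add: D_def zero_in_l1 H.l1_ideal_iff)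
  qed
  have add: "(\<lambda>x. f x + g x) \<in> D" if f: "f \<in> D" and g: "g \<in> D" for f g
  proof -
    have "coset_part G N s (\<lambda>x. f x + g x) = (\<lambda>x. coset_part G N s f x + coset_part G N s g x)" for s
      by (auto simp: coset_part_def)
    then show ?thesis
      using J(1) D1[OF f] D1[OF g] D2[OF f] D2[OF g] by (simp add: D_def l1_add H.l1_ideal_iff)
  qed
  have scale: "(\<lambda>x. c * f x) \<in> D" if f: "f \<in> D" for f c
  proof -
    have "coset_part G N s (\<lambda>x. c * f x) = (\<lambda>x. c * coset_part G N s f x)" for s
      by (auto simp: coset_part_def)
    then show ?thesis
      using J(1) D1[OF f] D2[OF f] by (simp add: D_def l1_scale H.l1_ideal_iff)
  qed
  have left: "conv G (delta s) f \<in> D" if f: "f \<in> D" and s: "s \<in> carrier G" for f s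
  proof -
    have "coset_part G N t (conv G (delta s) f) \<in> J" if t: "t \<in> carrier G" for t
    proof -
      have "coset_part G N t (conv G (delta s) f) = coset_part G N (inv s \<otimes> t) f"
        using s t by (auto simp: coset_part_def conv_delta_left m_assoc)
      with D2[OF f, of "inv s \<otimes> t"] s t show ?thesis by simp
    qed
    moreover have "conv G (delta s) f \<in> l1 G"
      using s D1[OF f] by (intro conv_in_l1 delta_in_l1)
    ultimately show ?thesis
      by (simp add: D_def)
  qed
  have right: "conv G f (delta s) \<in> D" if f: "f \<in> D" and s: "s \<in> carrier G" for f s
  proof -
    have "coset_part G N t (conv G f (delta s)) \<in> J" if t: "t \<in> carrier G" for t
    proof -
      let ?p = "coset_part G N (t \<otimes> inv s) f"
      let ?q = "conv G (conv G (delta (inv s)) ?p) (delta (inv (inv s)))"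
      have "?p \<in> J"
        using s t by (intro D2[OF f]) simp
      then have q: "?q \<in> J"
        using s by (intro conj_invariantD[OF J(3)]) simp_all
      have "coset_part G N t (conv G f (delta s)) = ?q"
      proof
        fix x
        show "coset_part G N t (conv G f (delta s)) x = ?q x"
        proof (cases "x \<in> N")
          case True
          have x: "x \<in> carrier G" and conj: "s \<otimes> x \<otimes> inv s \<in> N"
            using True N.inv_op_closed2[OF s True] by simp_all
          have "?q x = ?p (inv (inv s) \<otimes> x \<otimes> inv s)"
            using s x by (intro conv_delta_conj) simp_all
          also have "\<dots> = f (t \<otimes> inv s \<otimes> (s \<otimes> x \<otimes> inv s))"
            using conj s by (simp add: coset_part_def)
          also have "\<dots> = f (t \<otimes> x \<otimes> inv s)"
            using s t x by (simp add: m_assoc)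
          finally show ?thesis
            using True s t x by (simp add: coset_part_def conv_delta_right)
        next
          case False
          with J0[OF q False] show ?thesis
            by (simp add: coset_part_def)
        qed
      qed
      with q show ?thesis by simp
    qed
    moreover have "conv G f (delta s) \<in> l1 G"
      using s D1[OF f] by (intro conv_in_l1 delta_in_l1)
    ultimately show ?thesis
      by (simp add: D_def)
  qed
  have sub: "weak_star_closed_subspace G D"
    using closed zero add scale by (simp add: weak_star_closed_subspace_def)
  show "l1_ideal G (l1_direct_sum G T J)"
    unfolding sum_eq l1_ideal_iff
  proof (intro conjI ballI allI)
    fix f g assume f: "f \<in> D" and g: "g \<in> l1 G"
    show "conv G g f \<in> D"
      by (rule conv_in_subspace_left[OF sub D1[OF f] g left[OF f]])
    show "conv G f g \<in> D"
      by (rule conv_in_subspace_right[OF sub D1[OF f] g right[OF f]])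
  qed (use D1 zero add scale in auto)
qed

end

theorem theorem1p2:
  fixes G :: "('a, 'b) monoid_scheme" and T :: "'a set"
  assumes "group G"
    and "transversal G (FC G) T"
  shows "{I. l1_ideal G I \<and> closedin (weak_star G) I} =
    {l1_direct_sum G T J |J.
       l1_ideal (G\<lparr>carrier := FC G\<rparr>) J \<and> closedin (weak_star (G\<lparr>carrier := FC G\<rparr>)) J \<and>
       conj_invariant G J}"
proof (intro equalityI subsetI)
  interpret group G by (rule assms(1))
  fix I assume "I \<in> {I. l1_ideal G I \<and> closedin (weak_star G) I}"
  then have I: "l1_ideal G I" "closedin (weak_star G) I"
    by simp_all
  show "I \<in> {l1_direct_sum G T J |J. l1_ideal (G\<lparr>carrier := FC G\<rparr>) J \<and>
      closedin (weak_star (G\<lparr>carrier := FC G\<rparr>)) J \<and> conj_invariant G J}"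
    by (intro CollectI exI[of _ "I \<inter> l1 (G\<lparr>carrier := FC G\<rparr>)"] conjI
        closed_ideal_is_direct_sum(4)[OF I assms(2), symmetric]
        closed_ideal_is_direct_sum(1-3)[OF I assms(2)])
next
  interpret group G by (rule assms(1))
  fix I assume "I \<in> {l1_direct_sum G T J |J. l1_ideal (G\<lparr>carrier := FC G\<rparr>) J \<and>
      closedin (weak_star (G\<lparr>carrier := FC G\<rparr>)) J \<and> conj_invariant G J}"
  then obtain J where I: "I = l1_direct_sum G T J" and J: "l1_ideal (G\<lparr>carrier := FC G\<rparr>) J"
    "closedin (weak_star (G\<lparr>carrier := FC G\<rparr>)) J" "conj_invariant G J"
    by auto
  show "I \<in> {I. l1_ideal G I \<and> closedin (weak_star G) I}"
    unfolding I using direct_sum_is_closed_ideal[OF normal_FC assms(2) J] by simp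
qed

end
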